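(* Suppose that $u\in\mathcal{K}$ with corresponding closed set \[ E=\bigcup_{n\ge 0}[-b_n,-a_n], \] where $0\le a_0<b_0<a_1<b_1<\cdots$, and $a_n\to\infty$ as $n\to\infty$. If \[ a_n^{1/n}\to\infty\quad\text{as } n\to\infty, \] then \[ \rho(u)=\tfrac12\,\overline{\Lambda}(E^* )\quad\text{and}\quad \lambda(u)=\tfrac12\,\underline{\Lambda}(E^* ), \] where $E^*=\{|x|:x\in E\}$.
   Context: The class $\mathcal{K}$: a subharmonic function $u$ on $\mathbb{C}$ is in $\mathcal{K}$ if $u$ is continuous in $\mathbb{C}$ and positive harmonic in $D=\mathbb{C}\setminus E$, where $E\subset(-\infty,0]$ is a closed set on which $u$ vanishes, and each point of $E$ is regular for the Dirichlet problem in $D$. The set $E$ is called the closed set corresponding to $u$. For a continuous subharmonic function $u$ in $\mathbb{C}$ and $r>0$, $B(r,u)=\max_{|z|=r}u(z)$, and the order and lower order of $u$ are \[ \rho(u)=\limsup_{r\to\infty}\frac{\log B(r,u)}{\log r},\qquad \lambda(u)=\liminf_{r\to\infty}\frac{\log B(r,u)}{\log r}. \] For a (measurable) set $S\subset\mathbb{R}^+$, the upper and lower logarithmic densities of $S$ are \[ \overline{\Lambda}(S)=\limsup_{r\to\infty}\frac{1}{\log r}\int_{S\cap(1,r)}\frac{dt}{t},\qquad \underline{\Lambda}(S)=\liminf_{r\to\infty}\frac{1}{\log r}\int_{S\cap(1,r)}\frac{dt}{t}. \] *)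

theory Defs
  imports "HOL-Analysis.Analysis"
begin

(* The derivatives of u, u_x and u_y are written out in Re/Im coordinates, so that
   uxx, uxy, uyx, uyy are the second partial derivatives: u is C^2 with vanishing Laplacian. *)
definition harmonic_on :: "(complex \<Rightarrow> real) \<Rightarrow> complex set \<Rightarrow> bool" where
  "harmonic_on u S \<longleftrightarrow> open S \<and>
     (\<exists>ux uy uxx uxy uyx uyy.
        (\<forall>z\<in>S. (u has_derivative (\<lambda>h. ux z * Re h + uy z * Im h)) (at z) \<and>
                (ux has_derivative (\<lambda>h. uxx z * Re h + uxy z * Im h)) (at z) \<and>
                (uy has_derivative (\<lambda>h. uyx z * Re h + uyy z * Im h)) (at z) \<and>
                uxx z + uyy z = 0) \<and>
        continuous_on S uxx \<and> continuous_on S uxy \<and>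
        continuous_on S uyx \<and> continuous_on S uyy)"

(* Upper semicontinuity and the sub-mean-value inequality on every closed disc in S, for
   functions that do not take the value -infinity.  For such functions the integrals over
   circles are automatically finite; the integrability clause only prevents the inequality
   from being tested against the default value of the integral. *)
definition subharmonic_on :: "(complex \<Rightarrow> real) \<Rightarrow> complex set \<Rightarrow> bool" where
  "subharmonic_on u S \<longleftrightarrow> open S \<and>
     (\<forall>c. openin (top_of_set S) {z \<in> S. u z < c}) \<and>
     (\<forall>z r. r > 0 \<longrightarrow> cball z r \<subseteq> S \<longrightarrow>
        (\<lambda>t. u (z + of_real r * cis t)) absolutely_integrable_on {0..2*pi} \<and>
        u z \<le> 1 / (2*pi) * integral {0..2*pi} (\<lambda>t. u (z + of_real r * cis t)))"

(* The Dirichlet problem in D is taken on the boundary of D in the extended plane: L is the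
   boundary value at infinity.  If D is bounded, the filter at infinity is trivial and L plays
   no role.  Restricting to functions v that avoid -infinity does not change the supremum for
   bounded boundary data, since v may be replaced by max v m with m a lower bound of the data. *)
definition perron_family :: "complex set \<Rightarrow> (complex \<Rightarrow> real) \<Rightarrow> real \<Rightarrow> (complex \<Rightarrow> real) set" where
  "perron_family D \<phi> L = {v. subharmonic_on v D \<and>
     (\<forall>\<zeta>\<in>frontier D. Limsup (at \<zeta> within D) (\<lambda>z. ereal (v z)) \<le> ereal (\<phi> \<zeta>)) \<and>
     Limsup (inf at_infinity (principal D)) (\<lambda>z. ereal (v z)) \<le> ereal L}"

definition perron_solution :: "complex set \<Rightarrow> (complex \<Rightarrow> real) \<Rightarrow> real \<Rightarrow> complex \<Rightarrow> ereal" where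
  "perron_solution D \<phi> L z = (SUP v\<in>perron_family D \<phi> L. ereal (v z))"

(* For all boundary data continuous on the boundary of D in the extended plane, the Perron
   solution attains the prescribed value at the boundary point. *)
definition dirichlet_regular :: "complex set \<Rightarrow> complex \<Rightarrow> bool" where
  "dirichlet_regular D \<zeta> \<longleftrightarrow> \<zeta> \<in> frontier D \<and>
     (\<forall>\<phi> L. continuous_on (frontier D) \<phi> \<longrightarrow>
        (\<phi> \<longlongrightarrow> L) (inf at_infinity (principal (frontier D))) \<longrightarrow>
        (perron_solution D \<phi> L \<longlongrightarrow> ereal (\<phi> \<zeta>)) (at \<zeta> within D))"

(* u belongs to the class K, with corresponding closed set E *)
definition class_K :: "(complex \<Rightarrow> real) \<Rightarrow> complex set \<Rightarrow> bool" where
  "class_K u E \<longleftrightarrow>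
     subharmonic_on u UNIV \<and> continuous_on UNIV u \<and>
     closed E \<and> E \<subseteq> complex_of_real ` {..0} \<and>
     harmonic_on u (- E) \<and> (\<forall>z\<in>- E. u z > 0) \<and>
     (\<forall>z\<in>E. u z = 0) \<and>
     (\<forall>z\<in>E. dirichlet_regular (- E) z)"

(* For continuous u the supremum over the circle is attained. *)
definition max_circle :: "real \<Rightarrow> (complex \<Rightarrow> real) \<Rightarrow> real" where
  "max_circle r u = (SUP z\<in>sphere 0 r. u z)"

(* ln is meaningful where max_circle r u > 0; for u in the class K this holds for all r > 0. *)
definition growth_order :: "(complex \<Rightarrow> real) \<Rightarrow> ereal" where
  "growth_order u = Limsup at_top (\<lambda>r. ereal (ln (max_circle r u) / ln r))"

definition lower_growth_order :: "(complex \<Rightarrow> real) \<Rightarrow> ereal" where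
  "lower_growth_order u = Liminf at_top (\<lambda>r. ereal (ln (max_circle r u) / ln r))"

definition upper_log_density :: "real set \<Rightarrow> ereal" where
  "upper_log_density S =
     Limsup at_top (\<lambda>r. ereal (1 / ln r * (LINT t : S \<inter> {1<..<r} | lebesgue. 1 / t)))"

definition lower_log_density :: "real set \<Rightarrow> ereal" where
  "lower_log_density S =
     Liminf at_top (\<lambda>r. ereal (1 / ln r * (LINT t : S \<inter> {1<..<r} | lebesgue. 1 / t)))"

end

theory Submission
  imports Defs "HOL-Complex_Analysis.Complex_Analysis"
begin

text \<open>
Write \<open>B r\<close> for the maximum of \<open>u\<close> on the circle of radius \<open>r\<close> and \<open>L r\<close> for the logarithmic measure of
\<open>E\<^sup>* \<inter> (1, r)\<close>. The claim follows from \<open>ln (B r) = L r / 2 + o(ln r)\<close>, and this relation is obtained by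
following \<open>B\<close> across the intervals of \<open>E\<close> and the gaps between them.

Across an interval \<open>[a, b]\<close> of \<open>E\<^sup>*\<close> both \<open>ln B\<close> and \<open>L / 2\<close> increase by \<open>ln (r / a) / 2\<close> up to an absolute
constant. The upper bound (\<open>max_circle_le_sqrt\<close>) is Harnack's inequality with its sharp constant in the
plane slit along the negative axis. The lower bound (\<open>max_circle_le_across_slit\<close>) is a comparison with
an explicit majorant of harmonic measure in a slit disc. Across a gap \<open>L\<close> is constant, and \<open>ln B\<close>
increases by at most a constant plus \<open>ln (1 + ln (r / b))\<close> (\<open>max_circle_le_across_gap\<close>), because in an
annulus free of \<open>E\<close> the positive harmonic function \<open>u\<close> has a logarithmic minorant.

The hypothesis on \<open>a\<close> says that the number of intervals met before radius \<open>r\<close> is \<open>o(ln r)\<close>. So the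
constants contribute \<open>o(ln r)\<close> in total, and so do the iterated logarithms, since \<open>ln (1 + x)\<close> is
at most \<open>\<epsilon> * x\<close> plus a constant and the logarithmic lengths of the gaps add up to at most \<open>ln r\<close>
(\<open>error_over_ln_tendsto_0\<close>).

All comparisons use a maximum principle for functions that are locally real parts of
holomorphic functions (\<open>maximum_principle\<close>), so that potential theory reduces to the maximum modulus
principle and Schwarz's lemma. Estimates on a full circle are reduced to the positive axis by
\<open>max_circle_le_axis\<close>, which controls \<open>u\<close> near the slit, where Harnack's inequality degenerates.
\<close>

section \<open>Harmonic functions as real parts of holomorphic functions\<close>

text \<open>The mean value theorem in direction \<open>p\<close> turns the second difference into a first difference of
the derivative along \<open>p\<close>; the differentiability of the latter at the single point \<open>z\<close> then gives
the limit.\<close>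

lemma second_difference_tendsto:
  fixes u :: "'a::real_normed_vector \<Rightarrow> real"
  assumes S: "open S" "z \<in> S"
    and D: "\<And>w. w \<in> S \<Longrightarrow> (u has_derivative D w) (at w)"
    and A: "((\<lambda>w. D w p) has_derivative A) (at z)"
  shows "((\<lambda>t. (u (z + t *\<^sub>R p + t *\<^sub>R q) - u (z + t *\<^sub>R p) - u (z + t *\<^sub>R q) + u z) / t\<^sup>2)
            \<longlongrightarrow> A q) (at_right 0)"
proof (rule tendstoI)
  fix e :: real assume "e > 0"
  define M where "M = norm p + norm q + 1"
  have M: "M > 0" unfolding M_def by (smt (verit) norm_ge_zero)
  define \<epsilon> where "\<epsilon> = e / (4 * M)"
  have \<epsilon>: "\<epsilon> > 0" using \<open>e > 0\<close> M by (simp add: \<epsilon>_def)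
  obtain d where d: "d > 0"
    "\<And>y. norm (y - z) < d \<Longrightarrow> norm (D y p - D z p - A (y - z)) \<le> \<epsilon> * norm (y - z)"
    using A \<epsilon> unfolding has_derivative_at_alt by blast
  interpret A: bounded_linear A using A by (rule has_derivative_bounded_linear)
  obtain d' where d': "d' > 0" "ball z d' \<subseteq> S" using S openE by blast
  have main: "dist ((u (z + t *\<^sub>R p + t *\<^sub>R q) - u (z + t *\<^sub>R p) - u (z + t *\<^sub>R q) + u z) / t\<^sup>2) (A q) < e"
    if t: "0 < t" "t < min d d' / M" for t
  proof -
    have small: "norm (x *\<^sub>R p + y *\<^sub>R q) \<le> t * M" and small_less: "norm (x *\<^sub>R p + y *\<^sub>R q) < min d d'"
      if "0 \<le> x" "x \<le> t" "0 \<le> y" "y \<le> t" for x y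
    proof -
      have "norm (x *\<^sub>R p + y *\<^sub>R q) \<le> x * norm p + y * norm q"
        using that by (metis norm_triangle_ineq norm_scaleR abs_of_nonneg)
      also have "\<dots> \<le> t * norm p + t * norm q"
        using that by (intro add_mono mult_right_mono) auto
      also have "\<dots> \<le> t * M" using t by (simp add: M_def algebra_simps)
      finally show *: "norm (x *\<^sub>R p + y *\<^sub>R q) \<le> t * M" .
      also have "\<dots> < min d d'" using t M by (simp add: field_simps)
      finally show "norm (x *\<^sub>R p + y *\<^sub>R q) < min d d'" .
    qed
    have inS: "z + x *\<^sub>R p + y *\<^sub>R q \<in> S" if "0 \<le> x" "x \<le> t" "0 \<le> y" "y \<le> t" for x y
      using small_less[OF that] d'(2) by (auto simp: dist_norm subset_iff norm_minus_commute add.assoc algebra_simps)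
    \<comment> \<open>The second difference is the increment of \<open>\<phi>\<close> over \<open>[0, t]\<close>.\<close>
    define \<phi> where "\<phi> x = u (z + x *\<^sub>R p + t *\<^sub>R q) - u (z + x *\<^sub>R p)" for x
    have der: "(\<phi> has_real_derivative (D (z + x *\<^sub>R p + t *\<^sub>R q) p - D (z + x *\<^sub>R p) p)) (at x)"
      if "0 \<le> x" "x \<le> t" for x
    proof -
      have 1: "((\<lambda>x. u (z + x *\<^sub>R p + y *\<^sub>R q)) has_real_derivative D (z + x *\<^sub>R p + y *\<^sub>R q) p) (at x)"
        if "0 \<le> y" "y \<le> t" for y
      proof -
        have Dw: "(u has_derivative D (z + x *\<^sub>R p + y *\<^sub>R q)) (at (z + x *\<^sub>R p + y *\<^sub>R q))"
          using D inS that \<open>0 \<le> x\<close> \<open>x \<le> t\<close> by blast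
        have "((\<lambda>x. u (z + x *\<^sub>R p + y *\<^sub>R q)) has_derivative
               (\<lambda>h. D (z + x *\<^sub>R p + y *\<^sub>R q) (h *\<^sub>R p))) (at x)"
          by (rule has_derivative_compose[where f = "\<lambda>x. z + x *\<^sub>R p + y *\<^sub>R q" and g = u, OF _ Dw])
            (auto intro!: derivative_eq_intros)
        moreover have "D (z + x *\<^sub>R p + y *\<^sub>R q) (h *\<^sub>R p) = D (z + x *\<^sub>R p + y *\<^sub>R q) p * h" for h
          using linear_cmul[OF has_derivative_linear[OF Dw]] by (simp add: mult.commute)
        ultimately show ?thesis by (simp add: has_field_derivative_def)
      qed
      show ?thesis unfolding \<phi>_def using 1[of t] 1[of 0] t
        by (auto intro!: derivative_eq_intros)
    qed
    obtain \<xi> where \<xi>: "0 < \<xi>" "\<xi> < t"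
      "\<phi> t - \<phi> 0 = (t - 0) * (D (z + \<xi> *\<^sub>R p + t *\<^sub>R q) p - D (z + \<xi> *\<^sub>R p) p)"
      using MVT2[of 0 t \<phi> "\<lambda>x. D (z + x *\<^sub>R p + t *\<^sub>R q) p - D (z + x *\<^sub>R p) p"] t der by blast
    have Aest: "\<bar>D (z + \<xi> *\<^sub>R p + y *\<^sub>R q) p - D z p - A (\<xi> *\<^sub>R p + y *\<^sub>R q)\<bar> \<le> \<epsilon> * (t * M)"
      if "0 \<le> y" "y \<le> t" for y
    proof -
      have "\<bar>D (z + \<xi> *\<^sub>R p + y *\<^sub>R q) p - D z p - A (\<xi> *\<^sub>R p + y *\<^sub>R q)\<bar>
              \<le> \<epsilon> * norm (\<xi> *\<^sub>R p + y *\<^sub>R q)"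
        using d(2)[of "z + \<xi> *\<^sub>R p + y *\<^sub>R q"] small_less[of \<xi> y] \<xi> that by (simp add: add.assoc)
      also have "\<dots> \<le> \<epsilon> * (t * M)" using small[of \<xi> y] \<xi> that \<epsilon> by (intro mult_left_mono) auto
      finally show ?thesis .
    qed
    have "\<bar>(D (z + \<xi> *\<^sub>R p + t *\<^sub>R q) p - D (z + \<xi> *\<^sub>R p) p) - t * A q\<bar> \<le> 2 * (\<epsilon> * (t * M))"
      using Aest[of t] Aest[of 0] t by (simp add: A.add A.scaleR)
    also have "2 * (\<epsilon> * (t * M)) = t * e / 2" using M by (simp add: \<epsilon>_def field_simps)
    finally have *: "\<bar>(D (z + \<xi> *\<^sub>R p + t *\<^sub>R q) p - D (z + \<xi> *\<^sub>R p) p) - t * A q\<bar> \<le> t * e / 2" .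
    have "(u (z + t *\<^sub>R p + t *\<^sub>R q) - u (z + t *\<^sub>R p) - u (z + t *\<^sub>R q) + u z) / t\<^sup>2 - A q
        = (\<phi> t - \<phi> 0 - t\<^sup>2 * A q) / t\<^sup>2"
      using t by (simp add: \<phi>_def field_simps)
    also have "\<dots> = ((D (z + \<xi> *\<^sub>R p + t *\<^sub>R q) p - D (z + \<xi> *\<^sub>R p) p) - t * A q) / t"
      unfolding \<xi>(3) using t by (simp add: field_simps power2_eq_square)
    finally have "\<bar>(u (z + t *\<^sub>R p + t *\<^sub>R q) - u (z + t *\<^sub>R p) - u (z + t *\<^sub>R q) + u z) / t\<^sup>2 - A q\<bar>
        = \<bar>(D (z + \<xi> *\<^sub>R p + t *\<^sub>R q) p - D (z + \<xi> *\<^sub>R p) p) - t * A q\<bar> / t"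
      using t by simp
    also have "\<dots> \<le> (t * e / 2) / t" using * t by (intro divide_right_mono) auto
    also have "\<dots> = e / 2" using t by simp
    finally have "\<bar>(u (z + t *\<^sub>R p + t *\<^sub>R q) - u (z + t *\<^sub>R p) - u (z + t *\<^sub>R q) + u z) / t\<^sup>2 - A q\<bar>
        \<le> e / 2" .
    thus ?thesis using \<open>e > 0\<close> by (simp add: dist_real_def)
  qed
  show "\<forall>\<^sub>F t in at_right 0.
     dist ((u (z + t *\<^sub>R p + t *\<^sub>R q) - u (z + t *\<^sub>R p) - u (z + t *\<^sub>R q) + u z) / t\<^sup>2) (A q) < e"
    unfolding eventually_at_right_field
    using main d(1) d'(1) M by (intro exI[of _ "min d d' / M"]) auto
qed

text \<open>Young's theorem. The second difference along \<open>p\<close> and \<open>q\<close> is symmetric in the two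
directions, and its limit can be computed by differentiating in either direction first.\<close>

lemma mixed_derivatives_commute:
  fixes u :: "'a::real_normed_vector \<Rightarrow> real"
  assumes "open S" "z \<in> S"
    and "\<And>w. w \<in> S \<Longrightarrow> (u has_derivative D w) (at w)"
    and "((\<lambda>w. D w p) has_derivative A) (at z)" "((\<lambda>w. D w q) has_derivative B) (at z)"
  shows "A q = B p"
proof -
  have "(\<lambda>t. (u (z + t *\<^sub>R q + t *\<^sub>R p) - u (z + t *\<^sub>R q) - u (z + t *\<^sub>R p) + u z) / t\<^sup>2) =
        (\<lambda>t. (u (z + t *\<^sub>R p + t *\<^sub>R q) - u (z + t *\<^sub>R p) - u (z + t *\<^sub>R q) + u z) / t\<^sup>2)"
    by (simp add: algebra_simps)
  then have "((\<lambda>t. (u (z + t *\<^sub>R p + t *\<^sub>R q) - u (z + t *\<^sub>R p) - u (z + t *\<^sub>R q) + u z) / t\<^sup>2)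
            \<longlongrightarrow> B p) (at_right 0)"
    using second_difference_tendsto[OF assms(1-3,5), of p] by simp
  with second_difference_tendsto[OF assms(1-3,4), of q] show ?thesis
    by (rule tendsto_unique[OF trivial_limit_at_right_real])
qed

text \<open>The Cauchy--Riemann equations for \<open>ux - \<i> * uy\<close> are the symmetry of the second derivatives and
Laplace's equation. On a starlike set this function therefore has a holomorphic primitive, whose
real part has the same gradient as \<open>u\<close>.\<close>

lemma harmonic_on_imp_Re_holomorphic:
  assumes u: "harmonic_on u S" and T: "open T" "starlike T" "T \<subseteq> S"
  obtains F where "F holomorphic_on T" "\<And>z. z \<in> T \<Longrightarrow> Re (F z) = u z"
proof -
  from u obtain ux uy uxx uxy uyx uyy where S: "open S"
    and *: "\<forall>z\<in>S. (u has_derivative (\<lambda>h. ux z * Re h + uy z * Im h)) (at z) \<and>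
        (ux has_derivative (\<lambda>h. uxx z * Re h + uxy z * Im h)) (at z) \<and>
        (uy has_derivative (\<lambda>h. uyx z * Re h + uyy z * Im h)) (at z) \<and> uxx z + uyy z = 0"
    unfolding harmonic_on_def by (elim conjE exE) (rule that)
  have du: "(u has_derivative (\<lambda>h. ux z * Re h + uy z * Im h)) (at z)"
    and dux: "(ux has_derivative (\<lambda>h. uxx z * Re h + uxy z * Im h)) (at z)"
    and duy: "(uy has_derivative (\<lambda>h. uyx z * Re h + uyy z * Im h)) (at z)"
    and lap: "uxx z + uyy z = 0" if "z \<in> S" for z
    using * that by auto
  have sym: "uxy z = uyx z" if "z \<in> S" for z
    using mixed_derivatives_commute[OF S that du, where p = 1 and q = \<i>
        and A = "\<lambda>h. uxx z * Re h + uxy z * Im h" and B = "\<lambda>h. uyx z * Re h + uyy z * Im h"]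
      dux[OF that] duy[OF that] by simp
  define f where "f z = Complex (ux z) (- uy z)" for z
  have df: "(f has_field_derivative Complex (uxx z) (- uxy z)) (at z)" if z: "z \<in> S" for z
  proof -
    have f_eq: "f = (\<lambda>z. of_real (ux z) - \<i> * of_real (uy z))"
      by (auto simp: f_def complex_eq_iff)
    have "(f has_derivative (\<lambda>h. of_real (uxx z * Re h + uxy z * Im h)
              - \<i> * of_real (uyx z * Re h + uyy z * Im h))) (at z)"
      unfolding f_eq by (intro derivative_intros dux duy z)
    moreover have "uyy z = - uxx z" "uyx z = uxy z" using lap[OF z] sym[OF z] by auto
    ultimately show ?thesis
      unfolding has_field_derivative_def
      by (elim has_derivative_eq_rhs) (auto simp: fun_eq_iff complex_eq_iff algebra_simps)
  qed
  have "continuous_on T f"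
    by (rule DERIV_continuous_on, rule has_field_derivative_at_within, rule df) (use T(3) in auto)
  moreover have "f field_differentiable at z" if "z \<in> T" for z
    using df T(3) that unfolding field_differentiable_def by blast
  ultimately obtain G where G: "\<And>z. z \<in> T \<Longrightarrow> (G has_field_derivative f z) (at z)"
    using holomorphic_starlike_primitive[of T f "{}", OF _ T(2,1)] by auto
  obtain c where c: "c \<in> T" using T(2) unfolding starlike_def by blast
  have conn: "connected T" by (rule starlike_imp_connected[OF T(2)])
  have der0: "((\<lambda>z. u z - Re (G z)) has_derivative (\<lambda>h. 0)) (at z)" if z: "z \<in> T" for z
  proof -
    have "(G has_derivative (\<lambda>h. f z * h)) (at z)"
      using G[OF z] by (simp add: has_field_derivative_def)
    then have "((\<lambda>z. u z - Re (G z)) has_derivative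
        (\<lambda>h. (ux z * Re h + uy z * Im h) - Re (f z * h))) (at z)"
      by (intro derivative_intros du) (use z T in auto)
    then show ?thesis
      by (elim has_derivative_eq_rhs) (auto simp: fun_eq_iff f_def)
  qed
  define F where "F z = G z + of_real (u c - Re (G c))" for z
  show ?thesis
  proof
    have "G holomorphic_on T" using G has_field_derivative_at_within unfolding holomorphic_on_def field_differentiable_def by blast
    then show "F holomorphic_on T" unfolding F_def by (intro holomorphic_intros)
    show "Re (F z) = u z" if "z \<in> T" for z
      using has_derivative_zero_unique_connected[OF T(1) conn der0 that c] by (simp add: F_def)
  qed
qed

section \<open>Harnack's inequality in discs and in the slit plane\<close>

text \<open>Schwarz's lemma applied to the composition of \<open>F\<close> with the Cayley transform that maps the right
half-plane to the disc and \<open>F 0\<close> to \<open>0\<close>. The constant is sharp, and this matters below: it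
produces the exact growth exponent \<open>1/2\<close>.\<close>

lemma harnack_holomorphic_unit_disc:
  assumes F: "F holomorphic_on ball 0 1" and pos: "\<And>z. z \<in> ball 0 1 \<Longrightarrow> 0 < Re (F z)"
    and z: "norm z < 1"
  shows "Re (F z) * (1 - norm z) \<le> (1 + norm z) * Re (F 0)"
    and "Re (F 0) * (1 - norm z) \<le> (1 + norm z) * Re (F z)"
proof -
  define g where "g \<zeta> = (F \<zeta> - F 0) / (F \<zeta> + cnj (F 0))" for \<zeta>
  have p0: "0 < Re (F 0)" using pos by simp
  have nz: "F \<zeta> + cnj (F 0) \<noteq> 0" if "\<zeta> \<in> ball 0 1" for \<zeta>
    using pos[OF that] p0 by (auto simp: complex_eq_iff)
  have "g holomorphic_on ball 0 1"
    unfolding g_def by (intro holomorphic_intros F) (use nz in auto)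
  moreover have "g 0 = 0" by (simp add: g_def)
  moreover have "norm (g \<zeta>) < 1" if "norm \<zeta> < 1" for \<zeta>
  proof -
    have \<zeta>: "\<zeta> \<in> ball 0 1" using that by simp
    have "0 < Re (F \<zeta>) * Re (F 0)" using pos[OF \<zeta>] p0 by simp
    then have "(norm (F \<zeta> - F 0))\<^sup>2 < (norm (F \<zeta> + cnj (F 0)))\<^sup>2"
      unfolding cmod_power2 by (simp add: power2_eq_square algebra_simps)
    then have "norm (F \<zeta> - F 0) < norm (F \<zeta> + cnj (F 0))"
      by (rule power2_less_imp_less) simp
    then show ?thesis
      by (simp add: g_def norm_divide divide_simps)
  qed
  ultimately have "norm (g z) \<le> norm z"
    using Schwarz_Lemma(1)[of g z] z by blast
  then have "norm (F z - F 0) \<le> norm z * norm (F z + cnj (F 0))"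
    using nz[of z] z by (simp add: g_def norm_divide divide_simps)
  then have "(norm (F z - F 0))\<^sup>2 \<le> (norm z)\<^sup>2 * (norm (F z + cnj (F 0)))\<^sup>2"
    by (metis norm_ge_zero power_mono power_mult_distrib)
  then have "(Re (F z) - Re (F 0))\<^sup>2 + (1 - (norm z)\<^sup>2) * (Im (F z) - Im (F 0))\<^sup>2
      \<le> (norm z * (Re (F z) + Re (F 0)))\<^sup>2"
    unfolding cmod_power2[of "F z - F 0"] cmod_power2[of "F z + cnj (F 0)"] power_mult_distrib
    by (simp add: algebra_simps)
  moreover have "0 \<le> (1 - (norm z)\<^sup>2) * (Im (F z) - Im (F 0))\<^sup>2"
    using z by (intro mult_nonneg_nonneg) (auto simp: abs_square_le_1)
  ultimately have "(Re (F z) - Re (F 0))\<^sup>2 \<le> (norm z * (Re (F z) + Re (F 0)))\<^sup>2" by linarith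
  then have "\<bar>Re (F z) - Re (F 0)\<bar> \<le> norm z * (Re (F z) + Re (F 0))"
    using pos[of z] p0 z abs_le_square_iff[of "Re (F z) - Re (F 0)" "norm z * (Re (F z) + Re (F 0))"]
    by simp
  then show "Re (F z) * (1 - norm z) \<le> (1 + norm z) * Re (F 0)"
    and "Re (F 0) * (1 - norm z) \<le> (1 + norm z) * Re (F z)"
    by (auto simp: algebra_simps abs_le_iff)
qed

lemma harnack_ball:
  assumes u: "harmonic_on u S" and sub: "ball c R \<subseteq> S" and pos: "\<And>z. z \<in> ball c R \<Longrightarrow> 0 < u z"
    and z: "norm (z - c) < R"
  shows "(R - norm (z - c)) * u c \<le> (R + norm (z - c)) * u z"
proof -
  have R: "R > 0" using z by (smt (verit) norm_ge_zero)
  have "starlike (ball c R)" using R convex_imp_starlike[of "ball c R"] by auto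
  then obtain F where F: "F holomorphic_on ball c R" "\<And>z. z \<in> ball c R \<Longrightarrow> Re (F z) = u z"
    using harmonic_on_imp_Re_holomorphic[OF u open_ball _ sub] by blast
  define m where "m \<zeta> = c + of_real R * \<zeta>" for \<zeta> :: complex
  have m: "m \<zeta> \<in> ball c R" if "\<zeta> \<in> ball 0 1" for \<zeta>
    using that R by (simp add: m_def dist_norm norm_mult)
  have "(\<lambda>\<zeta>. F (m \<zeta>)) holomorphic_on ball 0 1"
    by (rule holomorphic_on_compose_gen[OF _ F(1), unfolded o_def])
      (use m in \<open>auto simp: m_def intro!: holomorphic_intros\<close>)
  moreover have "0 < Re (F (m \<zeta>))" if "\<zeta> \<in> ball 0 1" for \<zeta>
    using F(2)[OF m[OF that]] pos[OF m[OF that]] by simp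
  moreover define \<zeta> where "\<zeta> = (z - c) / of_real R"
  moreover have n\<zeta>: "norm \<zeta> = norm (z - c) / R" using R by (simp add: \<zeta>_def norm_divide)
  moreover have "norm \<zeta> < 1" using z R by (simp add: n\<zeta>)
  ultimately have "Re (F (m 0)) * (1 - norm \<zeta>) \<le> (1 + norm \<zeta>) * Re (F (m \<zeta>))"
    by (intro harnack_holomorphic_unit_disc(2)) auto
  moreover have "m 0 = c" "m \<zeta> = z" using R by (auto simp: m_def \<zeta>_def)
  moreover have "c \<in> ball c R" "z \<in> ball c R" using R z by (auto simp: dist_norm norm_minus_commute)
  ultimately have "u c * (1 - norm (z - c) / R) \<le> (1 + norm (z - c) / R) * u z"
    using F(2) by (simp add: n\<zeta>)
  then have "(u c * (1 - norm (z - c) / R)) * R \<le> ((1 + norm (z - c) / R) * u z) * R"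
    using R by (intro mult_right_mono) auto
  moreover have "(u c * (1 - norm (z - c) / R)) * R = (R - norm (z - c)) * u c"
    and "((1 + norm (z - c) / R) * u z) * R = (R + norm (z - c)) * u z"
    using R by (simp_all add: field_simps)
  ultimately show ?thesis by simp
qed

text \<open>The square root maps the slit plane to the right half-plane, so the function is the real part of a
holomorphic function there; the bound is the half-plane form of the previous estimate, in terms of
the pseudo-hyperbolic distance \<open>\<bar>p - q\<bar> / \<bar>p + cnj q\<bar>\<close>.\<close>

lemma harnack_slit_plane:
  assumes u: "harmonic_on u S" and sub: "- (complex_of_real ` {..0}) \<subseteq> S"
    and pos: "\<forall>z\<in>- (complex_of_real ` {..0}). 0 < u z"
    and p: "0 < Re p" and q: "0 < Re q"
  shows "u (p\<^sup>2) * (norm (p + cnj q) - norm (p - q)) \<le> (norm (p + cnj q) + norm (p - q)) * u (q\<^sup>2)"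
proof -
  let ?T = "- (complex_of_real ` {..0})"
  have opT: "open ?T"
    using closed_slot_left[of 0] by (simp add: open_Compl)
  obtain F where F: "F holomorphic_on ?T" "\<And>z. z \<in> ?T \<Longrightarrow> Re (F z) = u z"
    using harmonic_on_imp_Re_holomorphic[OF u opT starlike_slotted_complex_plane_left sub] by blast
  have sq: "w\<^sup>2 \<in> ?T" if w: "0 < Re w" for w
  proof
    assume "w\<^sup>2 \<in> complex_of_real ` {..0}"
    then have "Im (w\<^sup>2) = 0" "Re (w\<^sup>2) \<le> 0" by auto
    then show False using w mult_pos_pos[OF w w] by (auto simp: power2_eq_square)
  qed
  \<comment> \<open>\<open>m\<close> maps the disc to the right half-plane, sends \<open>0\<close> to \<open>q\<close> and \<open>(p - q) / (p + cnj q)\<close> to \<open>p\<close>.\<close>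
  define m where "m \<zeta> = (q + cnj q * \<zeta>) / (1 - \<zeta>)" for \<zeta>
  have m: "0 < Re (m \<zeta>)" if \<zeta>: "\<zeta> \<in> ball 0 1" for \<zeta>
  proof -
    have n1: "1 - \<zeta> \<noteq> 0" using \<zeta> by auto
    have "(norm \<zeta>)\<^sup>2 < 1" using \<zeta> by (simp add: abs_square_less_1)
    then have "0 < Re q * (1 - (norm \<zeta>)\<^sup>2)" using q by simp
    also have "\<dots> = Re ((q + cnj q * \<zeta>) * cnj (1 - \<zeta>))"
      unfolding cmod_power2 by (simp add: algebra_simps power2_eq_square)
    finally have *: "0 < Re ((q + cnj q * \<zeta>) * cnj (1 - \<zeta>))" .
    have "m \<zeta> = (q + cnj q * \<zeta>) * cnj (1 - \<zeta>) / of_real ((norm (1 - \<zeta>))\<^sup>2)"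
      unfolding m_def complex_norm_square using n1 by (simp add: divide_simps)
    then have "Re (m \<zeta>) = Re ((q + cnj q * \<zeta>) * cnj (1 - \<zeta>)) / (norm (1 - \<zeta>))\<^sup>2"
      by (metis Re_divide_of_real)
    then show ?thesis using * n1 by simp
  qed
  have "(\<lambda>\<zeta>. F ((m \<zeta>)\<^sup>2)) holomorphic_on ball 0 1"
  proof (rule holomorphic_on_compose_gen[OF _ F(1), unfolded o_def])
    show "(\<lambda>\<zeta>. (m \<zeta>)\<^sup>2) holomorphic_on ball 0 1"
      unfolding m_def by (intro holomorphic_intros) auto
    show "(\<lambda>\<zeta>. (m \<zeta>)\<^sup>2) ` ball 0 1 \<subseteq> ?T"
      by (rule image_subsetI) (rule sq, rule m)
  qed
  moreover have "0 < Re (F ((m \<zeta>)\<^sup>2))" if "\<zeta> \<in> ball 0 1" for \<zeta>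
    using F(2)[OF sq[OF m[OF that]]] bspec[OF pos sq[OF m[OF that]]] by simp
  moreover define \<zeta> where "\<zeta> = (p - q) / (p + cnj q)"
  moreover have nz: "p + cnj q \<noteq> 0" using p q by (auto simp: complex_eq_iff)
  then have n\<zeta>: "norm \<zeta> = norm (p - q) / norm (p + cnj q)" by (simp add: \<zeta>_def norm_divide)
  have "0 < Re p * Re q" using p q by simp
  then have "(norm (p - q))\<^sup>2 < (norm (p + cnj q))\<^sup>2"
    unfolding cmod_power2 by (simp add: power2_eq_square algebra_simps)
  then have "norm (p - q) < norm (p + cnj q)"
    by (rule power2_less_imp_less) simp
  then have "norm \<zeta> < 1" using nz by (simp add: n\<zeta>)
  ultimately have "Re (F ((m \<zeta>)\<^sup>2)) * (1 - norm \<zeta>) \<le> (1 + norm \<zeta>) * Re (F ((m 0)\<^sup>2))"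
    by (intro harnack_holomorphic_unit_disc(1)) auto
  moreover have "m 0 = q" by (simp add: m_def)
  moreover have "m \<zeta> = p"
  proof -
    have qq: "q + cnj q \<noteq> 0" using q by (auto simp: complex_eq_iff)
    have "1 - \<zeta> = (q + cnj q) / (p + cnj q)" using nz by (simp add: \<zeta>_def field_simps)
    moreover have "q + cnj q * \<zeta> = p * (q + cnj q) / (p + cnj q)"
      using nz by (simp add: \<zeta>_def field_simps)
    ultimately show ?thesis using nz qq by (simp add: m_def)
  qed
  ultimately have "u (p\<^sup>2) * (1 - norm \<zeta>) \<le> (1 + norm \<zeta>) * u (q\<^sup>2)"
    using F(2)[OF sq[OF p]] F(2)[OF sq[OF q]] by simp
  then have "u (p\<^sup>2) * (1 - norm \<zeta>) * norm (p + cnj q) \<le> (1 + norm \<zeta>) * u (q\<^sup>2) * norm (p + cnj q)"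
    by (intro mult_right_mono) auto
  moreover have "u (p\<^sup>2) * (1 - norm \<zeta>) * norm (p + cnj q) = u (p\<^sup>2) * (norm (p + cnj q) - norm (p - q))"
    and "(1 + norm \<zeta>) * u (q\<^sup>2) * norm (p + cnj q) = (norm (p + cnj q) + norm (p - q)) * u (q\<^sup>2)"
    using nz by (simp_all add: n\<zeta> field_simps)
  ultimately show ?thesis by simp
qed

text \<open>For points on the positive axis Harnack's constant is exactly \<open>sqrt (y / x)\<close>. Hence
\<open>u x / sqrt x\<close> decreases on the axis, so no positive harmonic function in the slit plane grows
faster than the square root there.\<close>

lemma harnack_slit_plane_positive_axis:
  assumes u: "harmonic_on u S" "- (complex_of_real ` {..0}) \<subseteq> S"
    "\<forall>z\<in>- (complex_of_real ` {..0}). 0 < u z"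
    and xy: "0 < x" "x \<le> y"
  shows "u (of_real y) \<le> sqrt (y / x) * u (of_real x)" "u (of_real x) \<le> sqrt (y / x) * u (of_real y)"
proof -
  let ?p = "complex_of_real (sqrt x)" and ?q = "complex_of_real (sqrt y)"
  have le: "sqrt x \<le> sqrt y" and y: "0 < y" using xy by auto
  have sq: "?p\<^sup>2 = of_real x" "?q\<^sup>2 = of_real y"
    using xy by (simp_all flip: of_real_power)
  have n: "norm (?q - ?p) = sqrt y - sqrt x" "norm (?q + ?p) = sqrt y + sqrt x"
    "norm (?p - ?q) = sqrt y - sqrt x" "norm (?p + ?q) = sqrt y + sqrt x"
    unfolding of_real_diff[symmetric] of_real_add[symmetric] norm_of_real using le xy by auto
  have "u (of_real y) * (2 * sqrt x) \<le> (2 * sqrt y) * u (of_real x)"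
    using harnack_slit_plane[OF u, of ?q ?p] n xy by (simp add: sq)
  then show "u (of_real y) \<le> sqrt (y / x) * u (of_real x)"
    using xy by (simp add: real_sqrt_divide field_simps)
  have "u (of_real x) * (2 * sqrt x) \<le> (2 * sqrt y) * u (of_real y)"
    using harnack_slit_plane[OF u, of ?p ?q] n xy y by (simp add: sq)
  then show "u (of_real x) \<le> sqrt (y / x) * u (of_real y)"
    using xy by (simp add: real_sqrt_divide field_simps)
qed

text \<open>Comparison with the value on the positive axis at the same distance from the origin. The factor
\<open>sqrt \<bar>z\<bar> / Re (csqrt z)\<close> is \<open>1 / cos (arg z / 2)\<close> and degenerates at the slit.\<close>

lemma harnack_slit_plane_circle:
  assumes u: "harmonic_on u S" "- (complex_of_real ` {..0}) \<subseteq> S"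
    "\<forall>z\<in>- (complex_of_real ` {..0}). 0 < u z"
    and w: "0 < Re (csqrt z)"
  shows "u z * Re (csqrt z) \<le> 4 * sqrt (norm z) * u (of_real (norm z))"
    and "u (of_real (norm z)) * Re (csqrt z) \<le> 4 * sqrt (norm z) * u z"
proof -
  define w where "w = csqrt z"
  define x where "x = sqrt (norm z)"
  have w0: "0 < Re w" and w2: "w\<^sup>2 = z" using w by (auto simp: w_def)
  have nw: "norm w = x" by (simp add: x_def w2[symmetric] norm_power)
  have x0: "0 < x" unfolding nw[symmetric] using w0 by auto
  have x2: "complex_of_real x ^ 2 = of_real (norm z)"
    by (simp add: x_def flip: of_real_power)
  define A B where "A = norm (w - of_real x)" and "B = norm (w + of_real x)"
  have "B\<^sup>2 - A\<^sup>2 = 4 * x * Re w"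
    unfolding A_def B_def cmod_power2 by (simp add: power2_eq_square algebra_simps)
  then have BA: "(B - A) * (B + A) = 4 * x * Re w" by (simp add: power2_eq_square algebra_simps)
  have AB0: "0 \<le> A" "0 \<le> B" by (simp_all add: A_def B_def)
  have "B \<le> 2 * x" unfolding B_def using norm_triangle_ineq[of w "of_real x"] nw x0 by simp
  moreover have "A \<le> 2 * x" unfolding A_def using norm_triangle_ineq4[of w "of_real x"] nw x0 by simp
  ultimately have "(B + A)\<^sup>2 \<le> (4 * x)\<^sup>2" using AB0 by (intro power_mono) auto
  then have sq: "(B + A) * (B + A) \<le> 16 * x * x" by (simp add: power2_eq_square)
  have zT: "z \<in> - (complex_of_real ` {..0})"
  proof
    assume "z \<in> complex_of_real ` {..0}"
    then have "Re (csqrt z) = 0" by auto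
    then show False using w by simp
  qed
  have xT: "complex_of_real (norm z) \<in> - (complex_of_real ` {..0})"
    using x0 by (auto simp: x_def simp del: norm_of_real)
  have main: "a * Re w \<le> 4 * x * b" if h: "a * (B - A) \<le> (B + A) * b" and ab: "0 < a" "0 < b" for a b
  proof -
    have "a * (4 * x * Re w) = a * (B - A) * (B + A)" by (simp add: BA[symmetric])
    also have "\<dots> \<le> (B + A) * b * (B + A)" using h AB0 by (intro mult_right_mono) auto
    also have "\<dots> \<le> 16 * x * x * b" using sq ab by (simp add: mult.commute mult.left_commute)
    finally have "(4 * x) * (a * Re w) \<le> (4 * x) * (4 * x * b)" by (simp add: algebra_simps)
    then show ?thesis by (rule mult_left_le_imp_le) (use x0 in simp)
  qed
  have "u z * (B - A) \<le> (B + A) * u (of_real (norm z))"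
    using harnack_slit_plane[OF u w0, of "of_real x"] x0 unfolding w2 x2 by (simp add: A_def B_def)
  from main[OF this] show "u z * Re (csqrt z) \<le> 4 * sqrt (norm z) * u (of_real (norm z))"
    using bspec[OF u(3) zT] bspec[OF u(3) xT] by (simp add: w_def x_def)
  have "norm (of_real x + cnj w) = B" unfolding B_def
    by (metis add.commute complex_cnj_add complex_cnj_complex_of_real complex_mod_cnj)
  then have "u (of_real (norm z)) * (B - A) \<le> (B + A) * u z"
    using harnack_slit_plane[OF u _ w0, of "of_real x"] x0 unfolding w2 x2
    by (simp add: A_def norm_minus_commute)
  from main[OF this] show "u (of_real (norm z)) * Re (csqrt z) \<le> 4 * sqrt (norm z) * u z"
    using bspec[OF u(3) zT] bspec[OF u(3) xT] by (simp add: w_def x_def)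
qed

section \<open>The maximum principle\<close>

text \<open>Harmonicity in a form that is closed under differences and gives access to the maximum modulus
principle.\<close>

definition locally_Re_holomorphic :: "(complex \<Rightarrow> real) \<Rightarrow> complex set \<Rightarrow> bool" where
  "locally_Re_holomorphic v S \<longleftrightarrow>
     (\<forall>z\<in>S. \<exists>e>0. \<exists>F. F holomorphic_on ball z e \<and> ball z e \<subseteq> S \<and> (\<forall>w\<in>ball z e. v w = Re (F w)))"

lemma harmonic_on_imp_locally_Re_holomorphic:
  assumes "harmonic_on u S"
  shows "locally_Re_holomorphic u S"
  unfolding locally_Re_holomorphic_def
proof
  fix z assume "z \<in> S"
  moreover have "open S" using assms by (simp add: harmonic_on_def)
  ultimately obtain e where e: "e > 0" "ball z e \<subseteq> S" using openE by blast
  have "starlike (ball z e)" using e convex_imp_starlike[of "ball z e"] by auto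
  then obtain F where F: "F holomorphic_on ball z e" "\<And>w. w \<in> ball z e \<Longrightarrow> Re (F w) = u w"
    using harmonic_on_imp_Re_holomorphic[OF assms open_ball _ e(2)] by blast
  with e show "\<exists>e>0. \<exists>F. F holomorphic_on ball z e \<and> ball z e \<subseteq> S \<and> (\<forall>w\<in>ball z e. u w = Re (F w))"
    by (intro exI[of _ e] conjI exI[of _ F]) auto
qed

lemma locally_Re_holomorphic_Re:
  assumes "F holomorphic_on S" "open S"
  shows "locally_Re_holomorphic (\<lambda>z. Re (F z)) S"
  unfolding locally_Re_holomorphic_def
proof
  fix z assume "z \<in> S"
  then obtain e where "e > 0" "ball z e \<subseteq> S" using assms(2) openE by blast
  then show "\<exists>e>0. \<exists>G. G holomorphic_on ball z e \<and> ball z e \<subseteq> S \<and> (\<forall>w\<in>ball z e. Re (F w) = Re (G w))"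
    using holomorphic_on_subset[OF assms(1)] by (intro exI[of _ e] conjI exI[of _ F]) auto
qed

lemma locally_Re_holomorphic_diff:
  assumes "locally_Re_holomorphic f S" "locally_Re_holomorphic g S"
  shows "locally_Re_holomorphic (\<lambda>z. f z - g z) S"
  unfolding locally_Re_holomorphic_def
proof
  fix z assume z: "z \<in> S"
  obtain d F where F: "d > 0" "F holomorphic_on ball z d" "ball z d \<subseteq> S" "\<forall>w\<in>ball z d. f w = Re (F w)"
    using assms(1) z unfolding locally_Re_holomorphic_def by blast
  obtain e G where G: "e > 0" "G holomorphic_on ball z e" "ball z e \<subseteq> S" "\<forall>w\<in>ball z e. g w = Re (G w)"
    using assms(2) z unfolding locally_Re_holomorphic_def by blast
  have "(\<lambda>z. F z - G z) holomorphic_on ball z (min d e)"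
    by (intro holomorphic_intros holomorphic_on_subset[OF F(2)] holomorphic_on_subset[OF G(2)]) auto
  then show "\<exists>e>0. \<exists>F. F holomorphic_on ball z e \<and> ball z e \<subseteq> S \<and> (\<forall>w\<in>ball z e. f w - g w = Re (F w))"
    using F G by (intro exI[of _ "min d e"] conjI exI[of _ "\<lambda>z. F z - G z"]) auto
qed

lemma locally_Re_holomorphic_affine:
  assumes "locally_Re_holomorphic f S"
  shows "locally_Re_holomorphic (\<lambda>z. c * f z + d) S"
  unfolding locally_Re_holomorphic_def
proof
  fix z assume z: "z \<in> S"
  obtain e F where F: "e > 0" "F holomorphic_on ball z e" "ball z e \<subseteq> S" "\<forall>w\<in>ball z e. f w = Re (F w)"
    using assms z unfolding locally_Re_holomorphic_def by blast
  have "(\<lambda>w. of_real c * F w + of_real d) holomorphic_on ball z e"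
    by (intro holomorphic_intros F)
  then show "\<exists>e>0. \<exists>G. G holomorphic_on ball z e \<and> ball z e \<subseteq> S \<and> (\<forall>w\<in>ball z e. c * f w + d = Re (G w))"
    using F by (intro exI[of _ e] conjI exI[of _ "\<lambda>w. of_real c * F w + of_real d"]) auto
qed

lemma locally_Re_holomorphic_ln_norm:
  "locally_Re_holomorphic (\<lambda>z. ln (norm z)) (- {0})"
  unfolding locally_Re_holomorphic_def
proof
  fix z :: complex assume z: "z \<in> - {0}"
  define F where "F w = Ln (w / z) + of_real (ln (norm z))" for w
  have nn: "w / z \<notin> \<real>\<^sub>\<le>\<^sub>0" if "w \<in> ball z (norm z)" for w
  proof
    assume *: "w / z \<in> \<real>\<^sub>\<le>\<^sub>0"
    have "norm (w / z - 1) = norm (w - z) / norm z"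
      using z by (simp add: diff_divide_distrib flip: norm_divide)
    then have "norm (w / z - 1) < 1" using that z by (simp add: dist_norm norm_minus_commute)
    moreover have "1 \<le> norm (w / z - 1)"
      using * abs_Re_le_cmod[of "w / z - 1"] by (auto simp: complex_nonpos_Reals_iff)
    ultimately show False by simp
  qed
  have hol: "F holomorphic_on ball z (norm z)"
    unfolding F_def by (intro holomorphic_intros) (use nn z in auto)
  have eq: "ln (norm w) = Re (F w)" if "w \<in> ball z (norm z)" for w
  proof -
    have "w \<noteq> 0" using that by (auto simp: dist_norm)
    then show ?thesis using z by (simp add: F_def norm_divide ln_div)
  qed
  show "\<exists>e>0. \<exists>F. F holomorphic_on ball z e \<and> ball z e \<subseteq> - {0} \<and> (\<forall>w\<in>ball z e. ln (norm w) = Re (F w))"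
    using z hol eq by (intro exI[of _ "norm z"] conjI exI[of _ F]) auto
qed

lemma locally_Re_holomorphic_subset:
  assumes "locally_Re_holomorphic v S" "T \<subseteq> S" "open T"
  shows "locally_Re_holomorphic v T"
  unfolding locally_Re_holomorphic_def
proof
  fix z assume z: "z \<in> T"
  obtain d F where F: "d > 0" "F holomorphic_on ball z d" "ball z d \<subseteq> S" "\<forall>w\<in>ball z d. v w = Re (F w)"
    using assms z unfolding locally_Re_holomorphic_def by blast
  obtain e where e: "e > 0" "ball z e \<subseteq> T" using assms z openE by blast
  have "F holomorphic_on ball z (min d e)" by (rule holomorphic_on_subset[OF F(2)]) auto
  then show "\<exists>e>0. \<exists>F. F holomorphic_on ball z e \<and> ball z e \<subseteq> T \<and> (\<forall>w\<in>ball z e. v w = Re (F w))"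
    using F e by (intro exI[of _ "min d e"] conjI exI[of _ F]) auto
qed

lemma locally_Re_holomorphic_imp_continuous_on:
  assumes "locally_Re_holomorphic v S"
  shows "continuous_on S v"
proof (rule continuous_at_imp_continuous_on, rule ballI)
  fix z assume "z \<in> S"
  then obtain e F where F: "e > 0" "F holomorphic_on ball z e" "\<forall>w\<in>ball z e. v w = Re (F w)"
    using assms unfolding locally_Re_holomorphic_def by blast
  have "continuous_on (ball z e) (\<lambda>w. Re (F w))"
    by (intro continuous_intros holomorphic_on_imp_continuous_on F)
  then have "continuous_on (ball z e) v" by (rule continuous_on_eq) (use F(3) in auto)
  then show "isCont v z" using F(1) by (simp add: continuous_on_eq_continuous_at)
qed

text \<open>If \<open>v\<close> were positive somewhere, the boundary condition would force it to attain its maximum. Near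
a maximum point \<open>v = Re F\<close> and \<open>\<bar>exp F\<bar> = exp v\<close>, so the maximum modulus principle shows that the
set of maximum points is open; it is also closed, hence the whole plane, although \<open>\<Omega>\<close> is bounded.\<close>

lemma maximum_principle:
  assumes \<Omega>: "open \<Omega>" "bounded \<Omega>" and v: "locally_Re_holomorphic v \<Omega>"
    and bdry: "\<And>\<zeta> \<epsilon>. \<lbrakk>\<zeta> \<in> frontier \<Omega>; \<epsilon> > 0\<rbrakk> \<Longrightarrow> \<forall>\<^sub>F z in at \<zeta> within \<Omega>. v z < \<epsilon>"
    and z: "z \<in> \<Omega>"
  shows "v z \<le> 0"
proof (rule ccontr)
  assume "\<not> v z \<le> 0"
  define K where "K = {w \<in> \<Omega>. v z \<le> v w}"
  have pos: "v z > 0" using \<open>\<not> v z \<le> 0\<close> by simp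
  have cont: "continuous_on \<Omega> v" by (rule locally_Re_holomorphic_imp_continuous_on[OF v])
  have "closed K"
    unfolding closed_sequential_limits
  proof (intro allI impI, elim conjE)
    fix x l assume x: "\<forall>n. x n \<in> K" and l: "x \<longlonglongrightarrow> l"
    have x\<Omega>: "x n \<in> \<Omega>" and xv: "v z \<le> v (x n)" for n using x by (auto simp: K_def)
    have lcl: "l \<in> closure \<Omega>" using x\<Omega> l closure_sequential by blast
    show "l \<in> K"
    proof (cases "l \<in> \<Omega>")
      case True
      then have "isCont v l" using cont \<Omega>(1) by (simp add: continuous_on_eq_continuous_at)
      then have "(\<lambda>n. v (x n)) \<longlonglongrightarrow> v l" using l isCont_tendsto_compose by blast
      then have "v z \<le> v l" using xv by (meson LIMSEQ_le_const)
      then show ?thesis using True by (simp add: K_def)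
    next
      case False
      then have "l \<in> frontier \<Omega>" using lcl \<Omega>(1) by (simp add: frontier_def interior_open)
      then have ev: "\<forall>\<^sub>F w in at l within \<Omega>. v w < v z" using bdry pos by blast
      have "filterlim x (at l within \<Omega>) sequentially"
        unfolding filterlim_at using l x\<Omega> False by (auto intro!: always_eventually)
      then have "\<forall>\<^sub>F n in sequentially. v (x n) < v z" using ev unfolding filterlim_iff by blast
      then obtain n where "v (x n) < v z" using eventually_happens' sequentially_bot by blast
      then show ?thesis using xv[of n] by simp
    qed
  qed
  moreover have "bounded K" using \<Omega>(2) by (rule bounded_subset) (auto simp: K_def)
  ultimately have cK: "compact K" by (simp add: compact_eq_bounded_closed)
  have zK: "z \<in> K" using z by (simp add: K_def)
  have contK: "continuous_on K v" using cont by (rule continuous_on_subset) (auto simp: K_def)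
  obtain \<xi> where \<xi>: "\<xi> \<in> K" "\<forall>w\<in>K. v w \<le> v \<xi>"
    using continuous_attains_sup[OF cK _ contK] zK by blast
  have max: "v w \<le> v \<xi>" if "w \<in> \<Omega>" for w
    using \<xi> zK that unfolding K_def by (cases "v z \<le> v w") auto
  define M where "M = {w \<in> K. v w = v \<xi>}"
  have "closed M"
    unfolding M_def using continuous_closed_preimage_constant[OF contK compact_imp_closed[OF cK]] .
  moreover have "open M"
    unfolding open_contains_ball
  proof
    fix w assume w: "w \<in> M"
    then have "w \<in> \<Omega>" by (simp add: M_def K_def)
    then obtain e F where F: "e > 0" "F holomorphic_on ball w e" "ball w e \<subseteq> \<Omega>" "\<forall>y\<in>ball w e. v y = Re (F y)"
      using v unfolding locally_Re_holomorphic_def by blast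
    have hol: "(\<lambda>y. exp (F y)) holomorphic_on ball w e" by (intro holomorphic_intros F)
    have "(\<lambda>y. exp (F y)) constant_on ball w e"
    proof (rule maximum_modulus_principle[OF hol open_ball connected_ball open_ball order_refl])
      show "w \<in> ball w e" using F by simp
      fix y assume "y \<in> ball w e"
      then show "cmod (exp (F y)) \<le> cmod (exp (F w))"
        using max[of y] F w by (auto simp: M_def)
    qed
    then obtain c where c: "\<And>y. y \<in> ball w e \<Longrightarrow> exp (F y) = c" unfolding constant_on_def by blast
    have "ball w e \<subseteq> M"
    proof
      fix y assume y: "y \<in> ball w e"
      have "exp (F y) = exp (F w)" using c[OF y] c[of w] F(1) by simp
      then have "exp (Re (F y)) = exp (Re (F w))" by (metis norm_exp_eq_Re)
      then have "v y = v w" using F y by simp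
      then show "y \<in> M" using w y F(3) by (auto simp: M_def K_def)
    qed
    then show "\<exists>e>0. ball w e \<subseteq> M" using F(1) by blast
  qed
  ultimately have "M = UNIV" using \<xi>(1) clopen[of M] by (auto simp: M_def)
  then have "\<Omega> = UNIV" by (auto simp: M_def K_def)
  then show False using \<Omega>(2) not_bounded_UNIV by simp
qed

text \<open>The form in which the maximum principle is used for functions vanishing on \<open>E\<close>: at points of \<open>E\<close>
nonnegativity of the majorant replaces any boundary condition.\<close>

lemma harmonic_le_majorant:
  assumes u: "continuous_on UNIV u" "harmonic_on u (- E)" "\<forall>z\<in>E. u z = 0"
    and \<Omega>: "open \<Omega>" "bounded \<Omega>" 
    and h: "locally_Re_holomorphic h (\<Omega> - E)" "\<And>z. z \<in> \<Omega> - E \<Longrightarrow> 0 \<le> h z"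
    and bdry: "\<And>\<zeta> \<epsilon>. \<lbrakk>\<zeta> \<in> frontier \<Omega> - E; \<epsilon> > 0\<rbrakk> \<Longrightarrow> \<forall>\<^sub>F z in at \<zeta> within \<Omega> - E. u z - h z < \<epsilon>"
    and z: "z \<in> \<Omega> - E"
  shows "u z \<le> h z"
proof -
  have opE: "open (- E)" using u(2) by (simp add: harmonic_on_def)
  have op: "open (\<Omega> - E)" using \<Omega>(1) opE by (simp add: Diff_eq open_Int)
  have "u z - h z \<le> 0"
  proof (rule maximum_principle[OF op])
    show "bounded (\<Omega> - E)" using \<Omega>(2) by (rule bounded_subset) auto
    show "locally_Re_holomorphic (\<lambda>z. u z - h z) (\<Omega> - E)"
      by (intro locally_Re_holomorphic_diff h(1) op locally_Re_holomorphic_subset[OF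
            harmonic_on_imp_locally_Re_holomorphic[OF u(2)]]) auto
    show "z \<in> \<Omega> - E" by fact
    fix \<zeta> and \<epsilon> :: real assume \<zeta>: "\<zeta> \<in> frontier (\<Omega> - E)" and \<epsilon>: "\<epsilon> > 0"
    show "\<forall>\<^sub>F z in at \<zeta> within \<Omega> - E. u z - h z < \<epsilon>"
    proof (cases "\<zeta> \<in> E")
      case True
      have "(u \<longlongrightarrow> u \<zeta>) (at \<zeta> within \<Omega> - E)"
        using u(1) by (meson UNIV_I continuous_on_def subset_UNIV tendsto_within_subset)
      then have "\<forall>\<^sub>F z in at \<zeta> within \<Omega> - E. u z < \<epsilon>"
        using order_tendstoD(2) bspec[OF u(3) True] \<epsilon> by fastforce
      moreover have "\<forall>\<^sub>F z in at \<zeta> within \<Omega> - E. z \<in> \<Omega> - E"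
        by (simp add: eventually_at_filter)
      ultimately show ?thesis
        by eventually_elim (use h(2) in fastforce)
    next
      case False
      have "\<zeta> \<notin> \<Omega> - E" "\<zeta> \<in> closure (\<Omega> - E)"
        using \<zeta> op by (auto simp: frontier_def interior_open)
      then have "\<zeta> \<in> frontier \<Omega> - E" using False \<Omega>(1)
        using closure_mono[of "\<Omega> - E" \<Omega>] by (auto simp: frontier_def interior_open)
      then show ?thesis using bdry \<epsilon> by blast
    qed
  qed
  then show ?thesis by simp
qed

section \<open>The maximum on a circle and the value on the positive axis\<close>

text \<open>Makes the degeneration of Harnack's constant at the slit explicit: it is at most of
order \<open>\<bar>z\<bar> / \<bar>Im z\<bar>\<close>.\<close>

lemma Re_csqrt_ge_Im:
  assumes "z \<noteq> 0"
  shows "\<bar>Im z\<bar> / (2 * sqrt (norm z)) \<le> Re (csqrt z)"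
proof -
  define r where "r = norm z"
  have r: "0 < r" using assms by (simp add: r_def)
  have le: "\<bar>Re z\<bar> \<le> r" by (simp add: r_def abs_Re_le_cmod)
  have "(Im z)\<^sup>2 = (r + Re z) * (r - Re z)"
    using cmod_power2[of z] by (simp add: r_def power2_eq_square algebra_simps)
  also have "\<dots> \<le> (r + Re z) * (2 * r)" using le by (intro mult_left_mono) auto
  finally have "(Im z)\<^sup>2 / (4 * r) \<le> (r + Re z) / 2" using r by (simp add: field_simps)
  then have "sqrt ((Im z)\<^sup>2 / (4 * r)) \<le> sqrt ((r + Re z) / 2)" by (rule real_sqrt_le_mono)
  moreover have "sqrt ((Im z)\<^sup>2 / (4 * r)) = \<bar>Im z\<bar> / (2 * sqrt r)"
    by (simp add: real_sqrt_divide real_sqrt_mult)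
  moreover have "sqrt ((r + Re z) / 2) = Re (csqrt z)" by (simp add: r_def)
  ultimately show ?thesis unfolding r_def by linarith
qed

text \<open>A positive harmonic function in the square \<open>\<bar>Re \<zeta>\<bar> + \<bar>Im \<zeta>\<bar> < 1\<close> that dominates a multiple of
\<open>1 / \<bar>Im \<zeta>\<bar>\<close> on the boundary of the square. It exists because the sides of the square meet the
real axis obliquely: on the rays \<open>arg p = \<pm>\<pi>/4\<close> the function \<open>Re (1 / p)\<close>
equals \<open>1 / (2 * \<bar>Im p\<bar>)\<close>.\<close>

definition square_majorant :: "complex \<Rightarrow> real" where
  "square_majorant \<zeta> = Re (1 / (1 + \<zeta>) + 1 / (1 - \<zeta>))"

lemma Re_inverse_ge_of_sector:
  assumes "\<bar>Im p\<bar> \<le> Re p" "0 < Re p"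
  shows "1 / (2 * Re p) \<le> Re (1 / p)"
proof -
  have "(Im p)\<^sup>2 \<le> (Re p)\<^sup>2" using assms by (metis abs_le_square_iff abs_of_pos)
  then have "(Re p)\<^sup>2 + (Im p)\<^sup>2 \<le> 2 * (Re p)\<^sup>2" by simp
  moreover have "0 < (Re p)\<^sup>2 + (Im p)\<^sup>2" using assms by (simp add: add_pos_nonneg)
  ultimately have "Re p / (2 * (Re p)\<^sup>2) \<le> Re p / ((Re p)\<^sup>2 + (Im p)\<^sup>2)"
    using assms by (intro divide_left_mono) auto
  then show ?thesis using assms by (simp add: Re_divide power2_eq_square)
qed

lemma Re_inverse_nonneg:
  assumes "0 \<le> Re p"
  shows "0 \<le> Re (1 / p)"
  using assms by (simp add: Re_divide)

lemma square_majorant_ge: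
  assumes "\<bar>Im \<zeta>\<bar> \<le> 1 - \<bar>Re \<zeta>\<bar>" "\<bar>Re \<zeta>\<bar> < 1"
  shows "1 / (2 * (1 - \<bar>Re \<zeta>\<bar>)) \<le> square_majorant \<zeta>"
proof (cases "0 \<le> Re \<zeta>")
  case True
  have "1 / (2 * (1 - \<bar>Re \<zeta>\<bar>)) \<le> Re (1 / (1 - \<zeta>))"
    using Re_inverse_ge_of_sector[of "1 - \<zeta>"] True assms by simp
  moreover have "0 \<le> Re (1 / (1 + \<zeta>))" using True by (intro Re_inverse_nonneg) simp
  ultimately show ?thesis by (simp add: square_majorant_def)
next
  case False
  have "1 / (2 * (1 - \<bar>Re \<zeta>\<bar>)) \<le> Re (1 / (1 + \<zeta>))"
    using Re_inverse_ge_of_sector[of "1 + \<zeta>"] False assms by simp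
  moreover have "0 \<le> Re (1 / (1 - \<zeta>))" using False by (intro Re_inverse_nonneg) simp
  ultimately show ?thesis by (simp add: square_majorant_def)
qed

lemma square_majorant_le:
  assumes "norm \<zeta> \<le> 1 / 2"
  shows "square_majorant \<zeta> \<le> 4"
proof -
  have "1 / 2 \<le> norm (1 + \<zeta>)" "1 / 2 \<le> norm (1 - \<zeta>)"
    using assms norm_triangle_ineq2[of 1 "- \<zeta>"] norm_triangle_ineq2[of 1 \<zeta>] by auto
  then have "norm (1 / (1 + \<zeta>)) \<le> 2" "norm (1 / (1 - \<zeta>)) \<le> 2"
    by (auto simp: norm_divide divide_simps)
  moreover have "square_majorant \<zeta> \<le> norm (1 / (1 + \<zeta>)) + norm (1 / (1 - \<zeta>))"
    unfolding square_majorant_def using complex_Re_le_cmod norm_triangle_ineq order_trans by blast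
  ultimately show ?thesis by simp
qed

lemma eventually_diff_less_at_within:
  fixes u h :: "complex \<Rightarrow> real"
  assumes "isCont u \<zeta>" "isCont h \<zeta>" "u \<zeta> \<le> h \<zeta>" "\<epsilon> > 0"
  shows "\<forall>\<^sub>F z in at \<zeta> within S. u z - h z < \<epsilon>"
proof -
  have "((\<lambda>z. u z - h z) \<longlongrightarrow> u \<zeta> - h \<zeta>) (at \<zeta> within S)"
    using assms(1,2) unfolding isCont_def
    by (intro tendsto_diff) (auto intro: tendsto_within_subset[where S = UNIV])
  then show ?thesis by (rule order_tendstoD(2)) (use assms in linarith)
qed

locale class_K_function =
  fixes u :: "complex \<Rightarrow> real" and E :: "complex set"
  assumes class_K: "class_K u E"
begin

lemma continuous: "continuous_on S u"
  using class_K continuous_on_subset unfolding class_K_def by blast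

lemma isCont [simp]: "isCont u z"
  using continuous[of UNIV] by (simp add: continuous_on_eq_continuous_at)

lemma harmonic: "harmonic_on u (- E)"
  using class_K unfolding class_K_def by blast

lemma zero: "z \<in> E \<Longrightarrow> u z = 0"
  using class_K unfolding class_K_def by blast

lemma pos: "z \<in> - E \<Longrightarrow> 0 < u z"
  using class_K unfolding class_K_def by blast

lemma nonneg: "0 \<le> u z"
  using zero[of z] pos[of z] by (cases "z \<in> E") auto

lemma slit: "E \<subseteq> complex_of_real ` {..0}"
  using class_K unfolding class_K_def by blast

lemma slit_plane: "- (complex_of_real ` {..0}) \<subseteq> - E"
  using slit by blast

lemma zero_on: "\<forall>z\<in>E. u z = 0"
  using zero by blast

lemma pos_slit_plane: "\<forall>z\<in>- (complex_of_real ` {..0}). 0 < u z"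
  using pos slit by blast

lemmas harnack_axis = harnack_slit_plane_positive_axis[OF harmonic slit_plane pos_slit_plane]
lemmas harnack_circle = harnack_slit_plane_circle[OF harmonic slit_plane pos_slit_plane]
lemmas le_majorant = harmonic_le_majorant[OF continuous harmonic zero_on]

lemma pos_axis: "0 < x \<Longrightarrow> 0 < u (of_real x)"
  by (rule bspec[OF pos_slit_plane]) auto

lemma le_max_circle: "u z \<le> max_circle (norm z) u"
proof -
  have "bdd_above (u ` sphere 0 (norm z))"
    by (intro bounded_imp_bdd_above compact_imp_bounded compact_continuous_image continuous) simp
  then show ?thesis unfolding max_circle_def by (intro cSUP_upper) auto
qed

lemma max_circle_attained:
  assumes "0 \<le> r"
  obtains z where "norm z = r" "u z = max_circle r u"
proof -
  have "sphere (0::complex) r \<noteq> {}" using assms by (simp add: sphere_eq_empty)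
  then obtain z where z: "z \<in> sphere 0 r" "\<forall>w\<in>sphere 0 r. u w \<le> u z"
    using continuous_attains_sup[OF compact_sphere _ continuous, of 0 r] by auto
  have "u z = max_circle r u"
    unfolding max_circle_def by (rule cSup_eq_maximum[symmetric]) (use z in auto)
  then show ?thesis using that z(1) by simp
qed

lemma axis_le_max_circle: "0 < r \<Longrightarrow> u (of_real r) \<le> max_circle r u"
  using le_max_circle[of "of_real r"] by simp

lemma max_circle_pos: "0 < r \<Longrightarrow> 0 < max_circle r u"
  using axis_le_max_circle pos_axis by fastforce

text \<open>The constant \<open>max_circle R u\<close> is a majorant of \<open>u\<close> in the disc of radius \<open>R\<close>.\<close>

lemma max_circle_mono:
  assumes r: "0 \<le> r" "r \<le> R"
  shows "max_circle r u \<le> max_circle R u"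
proof (cases "r = R")
  case False
  then have rR: "r < R" using r by simp
  obtain z where z: "norm z = r" "u z = max_circle r u" by (rule max_circle_attained[OF r(1)])
  have R0: "0 < max_circle R u" using max_circle_pos rR r by simp
  have opE: "open (- E)" using harmonic by (simp add: harmonic_on_def)
  have "u z \<le> max_circle R u" if "z \<in> ball 0 R - E"
  proof (rule le_majorant[OF open_ball bounded_ball, where h = "\<lambda>_. max_circle R u"])
    show "locally_Re_holomorphic (\<lambda>_. max_circle R u) (ball 0 R - E)"
      using locally_Re_holomorphic_Re[of "\<lambda>_. of_real (max_circle R u)" "ball 0 R - E"] opE
      by (simp add: Diff_eq open_Int)
    fix \<zeta> and \<epsilon> :: real assume \<zeta>: "\<zeta> \<in> frontier (ball 0 R) - E" and \<epsilon>: "0 < \<epsilon>"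
    show "\<forall>\<^sub>F z in at \<zeta> within ball 0 R - E. u z - max_circle R u < \<epsilon>"
      by (rule eventually_diff_less_at_within) (use \<zeta> \<epsilon> rR r le_max_circle[of \<zeta>] in auto)
  qed (use R0 that in auto)
  then show ?thesis using z rR R0 zero[of z] by (cases "z \<in> E") auto
qed simp

lemma le_axis_of_Im:
  assumes "Im z \<noteq> 0"
  shows "u z \<le> 8 * norm z / \<bar>Im z\<bar> * u (of_real (norm z))"
proof -
  have z: "z \<noteq> 0" using assms by auto
  have n: "0 < norm z" using z by simp
  define q where "q = \<bar>Im z\<bar> / (2 * sqrt (norm z))"
  have q: "0 < q" "q \<le> Re (csqrt z)" using assms z Re_csqrt_ge_Im[OF z] by (auto simp: q_def)
  have "u z * q \<le> u z * Re (csqrt z)" using q nonneg[of z] by (intro mult_left_mono) auto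
  also have "\<dots> \<le> 4 * sqrt (norm z) * u (of_real (norm z))"
    by (rule harnack_circle(1)) (use q in linarith)
  finally have "u z \<le> 4 * sqrt (norm z) * u (of_real (norm z)) / q"
    using q by (simp add: field_simps)
  also have "\<dots> = 8 * (sqrt (norm z) * sqrt (norm z)) / \<bar>Im z\<bar> * u (of_real (norm z))"
    using q assms by (simp add: q_def field_simps)
  finally show ?thesis by simp
qed

text \<open>Harnack's inequality gives a bound of order \<open>1 / \<bar>Im z\<bar>\<close> that is useless at the slit itself. On the
boundary of a square centred on the slit this bound is dominated by a harmonic function that is
bounded in the middle of the square, so that the maximum principle carries it across the slit; here
it is essential that \<open>u\<close> is continuous and vanishes on \<open>E\<close>.\<close>

lemma le_axis_near_slit:
  assumes r: "norm z = r" "0 < r" and x: "Re z < 0" and y: "\<bar>Im z\<bar> < r / 4"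
  shows "u z \<le> 384 * u (of_real r)"
proof (cases "z \<in> E")
  case True
  then show ?thesis using zero pos_axis[OF r(2)] by simp
next
  case False
  define m where "m = u (of_real r)"
  have m: "0 < m" using pos_axis[OF r(2)] by (simp add: m_def)
  define c where "c = Re z"
  define s where "s = r / 2"
  have s: "0 < s" using r by (simp add: s_def)
  have "c\<^sup>2 = r\<^sup>2 - (Im z)\<^sup>2" using cmod_power2[of z] r(1) by (simp add: c_def)
  moreover have "(Im z)\<^sup>2 < (r / 4)\<^sup>2" using y by (metis abs_ge_zero power2_abs power_strict_mono zero_less_numeral)
  moreover have "0 < r\<^sup>2" using r by simp
  moreover have "(r / 4)\<^sup>2 = r\<^sup>2 / 16" "(3 * r / 4)\<^sup>2 = 9 / 16 * r\<^sup>2" by (simp_all add: power2_eq_square)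
  ultimately have "(3 * r / 4)\<^sup>2 < \<bar>c\<bar>\<^sup>2" unfolding power2_abs by linarith
  then have c1: "3 * r / 4 < \<bar>c\<bar>" by (rule power_less_imp_less_base) simp
  have c2: "\<bar>c\<bar> \<le> r" using abs_Re_le_cmod[of z] r(1) by (simp add: c_def)
  \<comment> \<open>Coordinates in which the square of half-diagonal \<open>r / 2\<close> centred at \<open>Re z\<close> becomes the standard one.\<close>
  define \<zeta> where "\<zeta> w = (w - of_real c) / of_real s" for w :: complex
  have Re\<zeta>: "Re (\<zeta> w) = (Re w - c) / s" and Im\<zeta>: "Im (\<zeta> w) = Im w / s" for w
    by (auto simp: \<zeta>_def Re_divide_of_real Im_divide_of_real)
  have cont\<zeta>: "continuous_on A \<zeta>" for A unfolding \<zeta>_def by (intro continuous_intros) (use s in auto)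
  define \<Omega> where "\<Omega> = {w. \<bar>Re (\<zeta> w)\<bar> + \<bar>Im (\<zeta> w)\<bar> < 1}"
  define h where "h w = 96 * m * square_majorant (\<zeta> w)" for w
  have op: "open \<Omega>" unfolding \<Omega>_def by (intro open_Collect_less continuous_intros cont\<zeta>)
  have norm\<zeta>: "norm (w - of_real c) = s * norm (\<zeta> w)" for w using s by (simp add: \<zeta>_def norm_divide)
  have bd: "bounded \<Omega>"
  proof (rule bounded_subset[OF bounded_ball[of "of_real c" "s"]], rule subsetI)
    fix w assume "w \<in> \<Omega>"
    then have "norm (\<zeta> w) < 1" using cmod_le[of "\<zeta> w"] by (simp add: \<Omega>_def)
    then show "w \<in> ball (of_real c) s" using s by (simp add: dist_norm norm_minus_commute norm\<zeta>)
  qed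
  have ne: "1 + \<zeta> w \<noteq> 0" "1 - \<zeta> w \<noteq> 0" if "\<bar>Re (\<zeta> w)\<bar> < 1" for w
    using that by (auto simp: complex_eq_iff)
  have hh: "h = (\<lambda>w. Re (of_real (96 * m) * (1 / (1 + \<zeta> w) + 1 / (1 - \<zeta> w))))"
    unfolding h_def square_majorant_def by simp
  have bound: "u w \<le> 48 * m / \<bar>Im (\<zeta> w)\<bar>" if "norm (\<zeta> w) \<le> 1" "Im (\<zeta> w) \<noteq> 0" for w
  proof -
    \<comment> \<open>The square lies in \<open>r / 4 \<le> \<bar>w\<bar> \<le> 3 * r / 2\<close>, where the axis values are comparable with \<open>m\<close>.\<close>
    have imw: "Im w \<noteq> 0" using that s by (simp add: Im\<zeta>)
    have ds: "norm (w - of_real c) \<le> s" using that s by (simp add: norm\<zeta>)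
    have up: "norm w \<le> 3 * r / 2" using norm_triangle_ineq[of "w - of_real c" "of_real c"] ds c2 by (simp add: s_def)
    have lo: "r / 4 \<le> norm w" using norm_triangle_ineq2[of "of_real c" "of_real c - w"] ds c1
      by (simp add: s_def norm_minus_commute)
    have w0: "0 < norm w" using lo r by linarith
    have "u (of_real (norm w)) \<le> 2 * m"
    proof (cases "norm w \<le> r")
      case True
      have "u (of_real (norm w)) \<le> sqrt (r / norm w) * m"
        unfolding m_def by (rule harnack_axis(2)[OF w0 True])
      also have "sqrt (r / norm w) \<le> sqrt 4" using lo w0 by (intro real_sqrt_le_mono) (simp add: field_simps)
      finally show ?thesis using m by simp
    next
      case False
      have "u (of_real (norm w)) \<le> sqrt (norm w / r) * m"
        unfolding m_def by (rule harnack_axis(1)[OF r(2)]) (use False in auto)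
      also have "sqrt (norm w / r) \<le> sqrt 4" using up r by (intro real_sqrt_le_mono) (simp add: field_simps)
      finally show ?thesis using m by simp
    qed
    then have "8 * norm w / \<bar>Im w\<bar> * u (of_real (norm w)) \<le> 8 * (3 * r / 2) / \<bar>Im w\<bar> * (2 * m)"
      using up w0 m r by (intro mult_mono divide_right_mono) (auto intro: nonneg)
    then have "u w \<le> 24 * r * m / \<bar>Im w\<bar>" using le_axis_of_Im[OF imw] by simp
    also have "\<dots> = 48 * m / \<bar>Im (\<zeta> w)\<bar>" using r(2) by (simp add: Im\<zeta> s_def abs_divide abs_mult)
    finally show ?thesis .
  qed
  have hge: "48 * m / (1 - \<bar>Re (\<zeta> w)\<bar>) \<le> h w"
    if "\<bar>Im (\<zeta> w)\<bar> \<le> 1 - \<bar>Re (\<zeta> w)\<bar>" "\<bar>Re (\<zeta> w)\<bar> < 1" for w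
  proof -
    have "96 * m * (1 / (2 * t)) = 48 * m / t" for t by simp
    then show ?thesis
      using mult_left_mono[OF square_majorant_ge[OF that], of "96 * m"] m by (simp only: h_def)
  qed
  have \<zeta>z: "\<zeta> z = \<i> * of_real (Im z / s)" using s by (simp add: complex_eq_iff Re\<zeta> Im\<zeta> c_def)
  have n\<zeta>z: "norm (\<zeta> z) \<le> 1 / 2"
  proof -
    have "norm (\<zeta> z) = \<bar>Im z\<bar> / s" unfolding \<zeta>z norm_mult norm_of_real using s by simp
    also have "\<dots> \<le> 1 / 2" using y s by (simp add: s_def field_simps)
    finally show ?thesis .
  qed
  have "u z \<le> h z"
  proof (rule le_majorant[OF op bd])
    have hol\<zeta>: "\<zeta> holomorphic_on \<Omega> - E"
      unfolding \<zeta>_def by (intro holomorphic_intros) (use s in simp)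
    have "(\<lambda>w. of_real (96 * m) * (1 / (1 + \<zeta> w) + 1 / (1 - \<zeta> w))) holomorphic_on \<Omega> - E"
    proof (intro holomorphic_intros hol\<zeta>)
      fix w assume "w \<in> \<Omega> - E"
      then have "\<bar>Re (\<zeta> w)\<bar> < 1" by (auto simp: \<Omega>_def)
      then show "1 + \<zeta> w \<noteq> 0" "1 - \<zeta> w \<noteq> 0" by (rule ne)+
    qed
    then show "locally_Re_holomorphic h (\<Omega> - E)"
      unfolding hh using op harmonic by (intro locally_Re_holomorphic_Re) (auto simp: harmonic_on_def Diff_eq)
    show "0 \<le> h w" if "w \<in> \<Omega> - E" for w
    proof -
      have "\<bar>Re (\<zeta> w)\<bar> < 1" "\<bar>Im (\<zeta> w)\<bar> \<le> 1 - \<bar>Re (\<zeta> w)\<bar>" using that by (auto simp: \<Omega>_def)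
      then show ?thesis using hge[of w] m by (smt (verit) divide_nonneg_nonneg)
    qed
    have "Re (\<zeta> z) = 0" by (simp add: Re\<zeta> c_def)
    then show "z \<in> \<Omega> - E" using False n\<zeta>z abs_Im_le_cmod[of "\<zeta> z"] by (simp add: \<Omega>_def)
    fix w and \<epsilon> :: real assume w: "w \<in> frontier \<Omega> - E" and \<epsilon>: "0 < \<epsilon>"
    have "closed {w. \<bar>Re (\<zeta> w)\<bar> + \<bar>Im (\<zeta> w)\<bar> \<le> 1}"
      by (intro closed_Collect_le continuous_intros cont\<zeta>)
    then have "closure \<Omega> \<subseteq> {w. \<bar>Re (\<zeta> w)\<bar> + \<bar>Im (\<zeta> w)\<bar> \<le> 1}"
      by (rule closure_minimal[rotated]) (auto simp: \<Omega>_def)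
    moreover have "w \<in> closure \<Omega>" "w \<notin> \<Omega>" using w op by (auto simp: frontier_def interior_open)
    ultimately have edge: "\<bar>Re (\<zeta> w)\<bar> + \<bar>Im (\<zeta> w)\<bar> = 1" by (auto simp: \<Omega>_def)
    show "\<forall>\<^sub>F w in at w within \<Omega> - E. u w - h w < \<epsilon>"
    proof (cases "Im (\<zeta> w) = 0")
      case False
      have lt: "\<bar>Re (\<zeta> w)\<bar> < 1" using False edge by linarith
      have "norm (\<zeta> w) \<le> 1" using cmod_le[of "\<zeta> w"] edge by simp
      then have "u w \<le> 48 * m / \<bar>Im (\<zeta> w)\<bar>" using bound False by simp
      also have "\<dots> = 48 * m / (1 - \<bar>Re (\<zeta> w)\<bar>)" unfolding edge[symmetric] by simp
      also have "\<dots> \<le> h w" by (rule hge) (use edge lt in auto)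
      finally have "u w \<le> h w" .
      moreover have "isCont h w"
      proof -
        have c: "isCont \<zeta> w" using cont\<zeta>[of UNIV] by (simp add: continuous_on_eq_continuous_at)
        show ?thesis unfolding hh by (intro isCont_Re continuous_intros c) (use ne lt in auto)
      qed
      ultimately show ?thesis using \<epsilon> by (intro eventually_diff_less_at_within) auto
    next
      case True
      \<comment> \<open>At the two corners on the real axis \<open>u\<close> is bounded while the majorant tends to infinity.\<close>
      define M where "M = u w + 1"
      have M: "M > 0" unfolding M_def using nonneg[of w] by linarith
      have "(u \<longlongrightarrow> u w) (at w within \<Omega> - E)"
        using continuous[of UNIV] unfolding continuous_on_def by (meson UNIV_I subset_UNIV tendsto_within_subset)
      then have 1: "\<forall>\<^sub>F w in at w within \<Omega> - E. u w < M"
        by (rule order_tendstoD(2)) (simp add: M_def)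
      have "((\<lambda>w. 1 - \<bar>Re (\<zeta> w)\<bar>) \<longlongrightarrow> 1 - \<bar>Re (\<zeta> w)\<bar>) (at w within \<Omega> - E)"
        by (intro tendsto_intros, rule tendsto_within_subset[where S = UNIV])
          (use cont\<zeta>[of UNIV] in \<open>auto simp: continuous_on_def\<close>)
      then have 2: "\<forall>\<^sub>F w in at w within \<Omega> - E. 1 - \<bar>Re (\<zeta> w)\<bar> < 48 * m / M"
        by (rule order_tendstoD(2)) (use edge True m M in auto)
      have 3: "\<forall>\<^sub>F w in at w within \<Omega> - E. w \<in> \<Omega>" by (simp add: eventually_at_filter)
      show ?thesis using 1 2 3
      proof eventually_elim
        case (elim w)
        then have *: "\<bar>Im (\<zeta> w)\<bar> \<le> 1 - \<bar>Re (\<zeta> w)\<bar>" "\<bar>Re (\<zeta> w)\<bar> < 1" by (auto simp: \<Omega>_def)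
        have "M < 48 * m / (1 - \<bar>Re (\<zeta> w)\<bar>)" using elim(2) * M by (simp add: field_simps)
        also have "\<dots> \<le> h w" by (rule hge[OF *])
        finally show ?case using elim \<epsilon> by simp
      qed
    qed
  qed
  also have "h z \<le> 96 * m * 4"
    unfolding h_def using square_majorant_le[OF n\<zeta>z] m by (intro mult_left_mono) auto
  finally show ?thesis by (simp add: m_def)
qed

text \<open>Away from the slit this is Harnack's inequality, near the slit it is the preceding estimate. All
later estimates for circles can thus be reduced to the positive axis.\<close>

lemma max_circle_le_axis:
  assumes r: "0 < r"
  shows "max_circle r u \<le> 384 * u (of_real r)"
proof -
  obtain z where z: "norm z = r" "u z = max_circle r u" using max_circle_attained r by (metis less_imp_le)
  have pos: "0 < u (of_real r)" by (rule pos_axis[OF r])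
  consider "r / 4 \<le> \<bar>Im z\<bar>" | "\<bar>Im z\<bar> < r / 4" "Re z < 0" | "0 \<le> Re z" by linarith
  then have "u z \<le> 384 * u (of_real r)"
  proof cases
    case 1
    then have "u z \<le> 8 * r / \<bar>Im z\<bar> * u (of_real r)" using le_axis_of_Im[of z] r z by simp
    also have "8 * r / \<bar>Im z\<bar> \<le> 384" using 1 r by (simp add: field_simps)
    finally show ?thesis using pos by simp
  next
    case 2
    then show ?thesis using le_axis_near_slit z r by blast
  next
    case 3
    have "sqrt (r / 4) \<le> Re (csqrt z)"
      using 3 r z by (auto intro!: real_sqrt_le_mono)
    then have q: "sqrt r / 2 \<le> Re (csqrt z)" by (simp add: real_sqrt_divide)
    then have "u z * (sqrt r / 2) \<le> u z * Re (csqrt z)" using nonneg by (intro mult_left_mono)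
    also have "\<dots> \<le> 4 * sqrt r * u (of_real r)"
      using harnack_circle(1)[of z] q r z by (smt (verit) half_gt_zero real_sqrt_gt_zero)
    finally have "u z * sqrt r \<le> (8 * u (of_real r)) * sqrt r" by (simp add: mult_ac)
    then have "u z \<le> 8 * u (of_real r)" using r by (simp add: mult_le_cancel_right)
    then show ?thesis using pos by simp
  qed
  then show ?thesis using z by simp
qed

text \<open>Holds for every set \<open>E\<close> on the negative axis: the growth is never faster than that of the square
root.\<close>

lemma max_circle_le_sqrt:
  assumes "0 < a" "a \<le> r"
  shows "max_circle r u \<le> 384 * sqrt (r / a) * max_circle a u"
proof -
  have r: "0 < r" using assms by simp
  have "max_circle r u \<le> 384 * u (of_real r)" by (rule max_circle_le_axis[OF r])
  also have "\<dots> \<le> 384 * (sqrt (r / a) * u (of_real a))"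
    using harnack_axis(1)[OF assms] by simp
  also have "\<dots> \<le> 384 * (sqrt (r / a) * max_circle a u)"
    using axis_le_max_circle[OF assms(1)] r assms by (intro mult_left_mono) auto
  finally show ?thesis by simp
qed

end

section \<open>Growth along intervals of the zero set and across gaps\<close>

text \<open>The function \<open>Re (v / (v\<^sup>2 + R\<^sup>2))\<close> is half the sum of \<open>Re (1 / (v - \<i> * R))\<close> and
\<open>Re (1 / (v + \<i> * R))\<close>: positive and harmonic in the right half-plane, zero on the imaginary axis away from
the poles, and at least \<open>1 / (2 * R)\<close> on the half circle \<open>\<bar>v\<bar> = R\<close>. Up to a constant it is a majorant of the harmonic
measure of that half circle in the half disc, of order \<open>\<bar>v\<bar>\<close> near the origin.\<close>

lemma Re_half_disc_kernel_nonneg: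
  assumes "0 \<le> Re v"
  shows "0 \<le> Re (v / (v\<^sup>2 + of_real (R\<^sup>2)))"
proof -
  have "Re (v * cnj (v\<^sup>2 + of_real (R\<^sup>2))) = Re v * ((norm v)\<^sup>2 + R\<^sup>2)"
    unfolding cmod_power2 by (simp add: power2_eq_square algebra_simps)
  also have "\<dots> \<ge> 0" using assms by simp
  finally have "0 \<le> Re (v * cnj (v\<^sup>2 + of_real (R\<^sup>2)))" .
  then show ?thesis
    by (subst complex_div_cnj) (simp add: Re_divide_of_real del: of_real_power complex_cnj_add)
qed

lemma Re_half_disc_kernel_on_arc:
  assumes "0 < Re v" "norm v = R"
  shows "Re (v / (v\<^sup>2 + of_real (R\<^sup>2))) = 1 / (2 * Re v)"
proof -
  have "v \<noteq> 0" using assms by auto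
  have "v\<^sup>2 + of_real (R\<^sup>2) = v * (v + cnj v)"
    using complex_norm_square[of v] assms(2) by (simp add: power2_eq_square algebra_simps)
  also have "v + cnj v = of_real (2 * Re v)" by (rule complex_add_cnj)
  finally have "v / (v\<^sup>2 + of_real (R\<^sup>2)) = of_real (1 / (2 * Re v))"
    using \<open>v \<noteq> 0\<close> by simp
  then show ?thesis by simp
qed

context class_K_function
begin

text \<open>If the whole interval \<open>[-r, -a]\<close> belongs to \<open>E\<close>, then the square root of \<open>z + a\<close> opens the disc of
radius \<open>r - a\<close> about \<open>-a\<close>, slit along its negative radius, to a half disc on whose diameter \<open>u\<close>
vanishes. Inside such a half disc \<open>u\<close> is at most a multiple of \<open>\<bar>v\<bar> / R\<close> times its bound on the arc,
where \<open>\<bar>v\<bar>\<close> is of order \<open>sqrt a\<close> and \<open>R\<close> of order \<open>sqrt r\<close>.\<close>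

lemma max_circle_le_across_slit_aux:
  assumes a: "0 < a" "5 * a \<le> r" and E: "complex_of_real ` {- r..- a} \<subseteq> E"
  shows "max_circle a u \<le> 7 * sqrt (a / r) * max_circle r u"
proof -
  define M where "M = max_circle r u"
  define R where "R = sqrt (r - a)"
  define P where "P = r - a"
  have r: "0 < r" using a by linarith
  have P: "0 < P" "4 * a \<le> P" "r \<le> 5 / 4 * P" and R: "0 < R" "R\<^sup>2 = P"
    using a by (auto simp: P_def R_def)
  have M: "0 < M" unfolding M_def by (rule max_circle_pos[OF r])
  define \<Omega> where "\<Omega> = ball (- of_real a :: complex) P"
  define v where "v w = csqrt (w + of_real a)" for w
  define G where "G w = v w / ((v w)\<^sup>2 + of_real (R\<^sup>2))" for w
  \<comment> \<open>The factor \<open>2 * R\<close> makes the kernel at least \<open>1\<close> on the arc, where \<open>u\<close> is at most \<open>M\<close>.\<close>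
  define h where "h w = (2 * M * R) * Re (G w)" for w
  have h_eq: "h = (\<lambda>w. Re (of_real (2 * M * R) * G w))"
    unfolding h_def by (simp add: fun_eq_iff del: of_real_mult)
  have notreal: "w + of_real a \<notin> \<real>\<^sub>\<le>\<^sub>0" if "w \<in> cball (- of_real a) P - E" for w
  proof
    assume "w + of_real a \<in> \<real>\<^sub>\<le>\<^sub>0"
    then have *: "Im w = 0" "Re w \<le> - a" by (auto simp: complex_nonpos_Reals_iff)
    have "norm (w + of_real a) \<le> P" using that by (simp add: dist_norm norm_minus_commute add.commute)
    then have "\<bar>Re w + a\<bar> \<le> P" using abs_Re_le_cmod[of "w + of_real a"] by simp
    then have "Re w \<in> {- r..- a}" using * by (auto simp: P_def)
    moreover have "w = of_real (Re w)" using * by (simp add: complex_eq_iff)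
    ultimately have "w \<in> E" using E by (metis image_eqI subsetD)
    then show False using that by simp
  qed
  have Rev: "0 < Re (v w)" if "w \<in> cball (- of_real a) P - E" for w
  proof -
    have "Re (v w) \<noteq> 0"
    proof
      assume "Re (v w) = 0"
      then have "(v w)\<^sup>2 \<in> \<real>\<^sub>\<le>\<^sub>0" by (simp add: complex_nonpos_Reals_iff power2_eq_square)
      then show False using notreal[OF that] by (simp add: v_def)
    qed
    then show ?thesis using Re_csqrt[of "w + of_real a"] by (simp add: v_def)
  qed
  have den: "(v w)\<^sup>2 + of_real (R\<^sup>2) \<noteq> 0" if "w \<in> cball (- of_real a) P - E" for w
  proof
    assume "(v w)\<^sup>2 + of_real (R\<^sup>2) = 0"
    then have "w + of_real a = of_real (- P)" using R by (simp add: v_def eq_neg_iff_add_eq_0)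
    then show False using notreal[OF that] P by simp
  qed
  have le: "u z \<le> h z" if z: "z \<in> \<Omega> - E" for z
  proof (rule le_majorant[of \<Omega>])
    have sub: "\<Omega> - E \<subseteq> cball (- of_real a) P - E" by (auto simp: \<Omega>_def)
    have holv: "v holomorphic_on \<Omega> - E"
      unfolding v_def by (intro holomorphic_intros) (use notreal sub in auto)
    have "(\<lambda>w. of_real (2 * M * R) * G w) holomorphic_on \<Omega> - E"
      unfolding G_def by (intro holomorphic_intros holv) (use den sub in auto)
    then show "locally_Re_holomorphic h (\<Omega> - E)"
      unfolding h_eq using harmonic
      by (intro locally_Re_holomorphic_Re) (auto simp: harmonic_on_def Diff_eq \<Omega>_def)
    show "0 \<le> h w" if "w \<in> \<Omega> - E" for w
    proof -
      have "0 < Re (v w)" using Rev that sub by blast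
      then have "0 \<le> Re (G w)" unfolding G_def by (intro Re_half_disc_kernel_nonneg) simp
      then show ?thesis using M R by (simp add: h_def)
    qed
    fix \<zeta> and \<epsilon> :: real assume \<zeta>: "\<zeta> \<in> frontier \<Omega> - E" and \<epsilon>: "0 < \<epsilon>"
    have \<zeta>P: "norm (\<zeta> + of_real a) = P"
      using \<zeta> P by (simp add: \<Omega>_def dist_norm norm_minus_commute add.commute)
    then have \<zeta>c: "\<zeta> \<in> cball (- of_real a) P - E"
      using \<zeta> by (simp add: dist_norm norm_minus_commute add.commute)
    have nv: "norm (v \<zeta>) = R"
    proof -
      have "(norm (v \<zeta>))\<^sup>2 = P" unfolding norm_power[symmetric] by (simp add: v_def \<zeta>P)
      then have "(norm (v \<zeta>))\<^sup>2 = R\<^sup>2" using R by simp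
      then show ?thesis by (rule power2_eq_imp_eq) (use R in auto)
    qed
    have "h \<zeta> = (2 * M * R) * (1 / (2 * Re (v \<zeta>)))"
      unfolding h_def G_def using Re_half_disc_kernel_on_arc[OF Rev[OF \<zeta>c] nv] by (simp del: of_real_power)
    moreover have "Re (v \<zeta>) \<le> R" using nv complex_Re_le_cmod[of "v \<zeta>"] by simp
    moreover have "M * Re (v \<zeta>) \<le> M * R" using calculation(2) M by (intro mult_left_mono) auto
    ultimately have "M \<le> h \<zeta>" using Rev[OF \<zeta>c] by (simp add: pos_le_divide_eq)
    moreover have "norm \<zeta> \<le> r"
      using norm_triangle_ineq4[of "\<zeta> + of_real a" "of_real a"] \<zeta>P a by (simp add: P_def)
    then have "u \<zeta> \<le> M"
      using le_max_circle[of \<zeta>] max_circle_mono[of "norm \<zeta>" r] by (simp add: M_def)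
    moreover have "isCont h \<zeta>"
    proof -
      have c: "isCont v \<zeta>" unfolding v_def
        by (rule isCont_o2[where g = csqrt]) (auto intro!: continuous_intros continuous_at_csqrt notreal[OF \<zeta>c])
      show ?thesis
        unfolding h_def G_def by (intro continuous_intros isCont_Re c) (use den[OF \<zeta>c] in auto)
    qed
    ultimately show "\<forall>\<^sub>F z in at \<zeta> within \<Omega> - E. u z - h z < \<epsilon>"
      using \<epsilon> by (intro eventually_diff_less_at_within) auto
  qed (use z in \<open>auto simp: \<Omega>_def\<close>)
  obtain z where z: "norm z = a" "u z = max_circle a u" using max_circle_attained a by (metis less_imp_le)
  show ?thesis
  proof (cases "z \<in> E")
    case True
    then have "max_circle a u = 0" using z zero by simp
    then show ?thesis using max_circle_pos[OF a(1)] by simp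
  next
    case False
    have za: "norm (z + of_real a) \<le> 2 * a" using norm_triangle_ineq[of z "of_real a"] z a by simp
    then have z\<Omega>: "z \<in> \<Omega> - E" using False P a
      by (simp add: \<Omega>_def dist_norm norm_minus_commute add.commute)
    have nv2: "(norm (v z))\<^sup>2 = norm (z + of_real a)" unfolding norm_power[symmetric] by (simp add: v_def)
    then have "norm (v z) \<le> sqrt (2 * a)" using za by (simp add: real_le_rsqrt)
    moreover have "P / 2 \<le> norm ((v z)\<^sup>2 + of_real (R\<^sup>2))"
    proof -
      have "P - 2 * a \<le> norm (of_real P + (z + of_real a))"
        using norm_triangle_ineq4[of "of_real P + (z + of_real a)" "z + of_real a"] za P by simp
      then show ?thesis using P R by (simp add: v_def add_ac)
    qed
    ultimately have "norm (G z) \<le> sqrt (2 * a) / (P / 2)"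
      unfolding G_def norm_divide using P a by (intro frac_le) auto
    then have "(2 * M * R) * norm (G z) \<le> (2 * M * R) * (sqrt (2 * a) / (P / 2))"
      using M R by (intro mult_left_mono) auto
    moreover have "h z \<le> (2 * M * R) * norm (G z)"
      unfolding h_def using complex_Re_le_cmod[of "G z"] M R by (intro mult_left_mono) auto
    ultimately have "u z \<le> (2 * M * R) * (sqrt (2 * a) / (P / 2))" using le[OF z\<Omega>] by linarith
    also have "\<dots> = M * (4 * sqrt (2 * a) / R)"
      using R(1) unfolding R(2)[symmetric] by (simp add: field_simps power2_eq_square)
    also have "4 * sqrt (2 * a) / R = sqrt (32 * a / P)"
      using real_sqrt_mult[of 16 "2 * a"] by (simp add: R_def P_def real_sqrt_divide)
    also have "32 * a / P \<le> 49 * (a / r)" using P a r by (simp add: field_simps)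
    then have "M * sqrt (32 * a / P) \<le> M * sqrt (49 * (a / r))" using M by (intro mult_left_mono) auto
    also have "sqrt (49 * (a / r)) = 7 * sqrt (a / r)"
      using real_sqrt_mult[of 49 "a / r"] by simp
    finally show ?thesis using z by (simp add: M_def mult_ac)
  qed
qed

text \<open>Reverse of the square root bound: along an interval contained in \<open>E\<close> the maximum grows at
least like the square root.\<close>

lemma max_circle_le_across_slit:
  assumes a: "0 < a" "a \<le> r" and E: "complex_of_real ` {- r..- a} \<subseteq> E"
  shows "max_circle a u \<le> 7 * sqrt (a / r) * max_circle r u"
proof (cases "5 * a \<le> r")
  case True
  then show ?thesis using max_circle_le_across_slit_aux a E by blast
next
  case False
  have r: "0 < r" using a by linarith
  have "1 / 49 \<le> a / r" using False r by (simp add: field_simps)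
  then have "sqrt (1 / 49) \<le> sqrt (a / r)" by (rule real_sqrt_le_mono)
  moreover have "sqrt (1 / 49) = (1 / 7 :: real)" by (simp add: real_sqrt_divide)
  ultimately have "1 \<le> 7 * sqrt (a / r)" by linarith
  then have "max_circle r u \<le> 7 * sqrt (a / r) * max_circle r u"
    using max_circle_pos[OF r] by simp
  then show ?thesis using max_circle_mono[of a r] a by linarith
qed

text \<open>When the circle stays away from \<open>E\<close>, Harnack's inequality also bounds \<open>u\<close> from below on it, including
near the negative axis, which is reached through a disc centred off the axis.\<close>

lemma axis_le_circle_in_gap:
  assumes b: "0 < b" "16 * b \<le> \<rho>" and gap: "\<And>w. w \<in> E \<Longrightarrow> norm w \<le> b \<or> 2 * \<rho> \<le> norm w"
    and z: "norm z = \<rho>"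
  shows "u (of_real \<rho>) \<le> 490 * u z"
proof -
  have \<rho>: "0 < \<rho>" using b by linarith
  have sector: "u (of_real \<rho>) \<le> 10 * u w" if w: "norm w = \<rho>" "- 3 / 5 * \<rho> \<le> Re w" for w
  proof -
    have "sqrt (4 / 25 * \<rho>) \<le> Re (csqrt w)"
      using w \<rho> by (auto intro!: real_sqrt_le_mono)
    moreover have "sqrt (4 / 25 * \<rho>) = 2 / 5 * sqrt \<rho>" by (simp add: real_sqrt_mult real_sqrt_divide)
    ultimately have q: "2 / 5 * sqrt \<rho> \<le> Re (csqrt w)" by linarith
    then have "u (of_real \<rho>) * (2 / 5 * sqrt \<rho>) \<le> u (of_real \<rho>) * Re (csqrt w)"
      using nonneg by (intro mult_left_mono)
    also have "\<dots> \<le> 4 * sqrt \<rho> * u w"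
    proof -
      have "0 < 2 / 5 * sqrt \<rho>" using \<rho> by simp
      then have "0 < Re (csqrt w)" using q by linarith
      then show ?thesis using harnack_circle(2)[of w] w by simp
    qed
    finally have "(sqrt \<rho> * 2 / 5) * u (of_real \<rho>) \<le> (sqrt \<rho> * 2 / 5) * (10 * u w)" by (simp add: mult_ac)
    then show ?thesis by (rule mult_left_le_imp_le) (use \<rho> in simp)
  qed
  show ?thesis
  proof (cases "0 \<le> Re z")
    case True
    then show ?thesis using sector[OF z] \<rho> nonneg[of z] by simp
  next
    case False
    define \<sigma> :: real where "\<sigma> = (if 0 \<le> Im z then 1 else - 1)"
    \<comment> \<open>A rational point of the circle in the same quadrant as \<open>z\<close>: it lies in the sector already treated
        and at distance at most \<open>9 / 10 * \<rho>\<close> from \<open>z\<close>; the disc of radius \<open>15 / 16 * \<rho>\<close> about it is free of \<open>E\<close>.\<close>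
    define c where "c = Complex (- 3 / 5 * \<rho>) (\<sigma> * (4 / 5) * \<rho>)"
    have \<sigma>: "\<sigma>\<^sup>2 = 1" "\<sigma> * Im z = \<bar>Im z\<bar>" by (auto simp: \<sigma>_def)
    have "(norm c)\<^sup>2 = \<rho>\<^sup>2"
      unfolding cmod_power2 c_def using \<sigma> by (simp add: power_mult_distrib power_divide field_simps)
    then have nc: "norm c = \<rho>" using \<rho> by (simp add: power2_eq_iff_nonneg)
    have z2: "(Re z)\<^sup>2 + (Im z)\<^sup>2 = \<rho>\<^sup>2" using cmod_power2[of z] z by simp
    have "\<rho> \<le> \<bar>Re z\<bar> + \<bar>Im z\<bar>" using cmod_le[of z] z by simp
    then have low: "\<rho> * \<rho> \<le> \<rho> * (\<bar>Re z\<bar> + \<bar>Im z\<bar>)" using \<rho> by (intro mult_left_mono) auto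
    have "(norm (z - c))\<^sup>2 = (Re z + 3 / 5 * \<rho>)\<^sup>2 + (Im z - \<sigma> * (4 / 5) * \<rho>)\<^sup>2"
      unfolding cmod_power2 c_def by simp
    also have "\<dots> = ((Re z)\<^sup>2 + (Im z)\<^sup>2) + (9 / 25 + \<sigma>\<^sup>2 * (16 / 25)) * \<rho>\<^sup>2 + 6 / 5 * \<rho> * Re z - 8 / 5 * \<rho> * (\<sigma> * Im z)"
      by (simp add: power2_eq_square algebra_simps)
    also have "\<dots> = 2 * \<rho>\<^sup>2 - 6 / 5 * (\<rho> * (\<bar>Re z\<bar> + \<bar>Im z\<bar>)) - 2 / 5 * (\<rho> * \<bar>Im z\<bar>)"
      using z2 \<sigma> False by (simp add: algebra_simps)
    also have "\<dots> \<le> (9 / 10 * \<rho>)\<^sup>2"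
    proof -
      have "0 \<le> \<rho> * \<bar>Im z\<bar>" using \<rho> by simp
      moreover have "(9 / 10 * \<rho>)\<^sup>2 = 81 / 100 * \<rho>\<^sup>2" by (simp add: power2_eq_square)
      ultimately show ?thesis using low zero_le_power2[of \<rho>] unfolding power2_eq_square[symmetric] by linarith
    qed
    finally have d: "norm (z - c) \<le> 9 / 10 * \<rho>"
      by (rule power2_le_imp_le) (use \<rho> in simp)
    have sub: "ball c (15 / 16 * \<rho>) \<subseteq> - E"
    proof
      fix w assume "w \<in> ball c (15 / 16 * \<rho>)"
      then have "norm (c - w) < 15 / 16 * \<rho>" by (simp add: dist_norm)
      then have "norm w < 2 * \<rho>" "\<rho> / 16 < norm w"
        using norm_triangle_ineq2[of c "c - w"] norm_triangle_ineq2[of w c] nc \<rho>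
        by (auto simp: norm_minus_commute)
      then show "w \<in> - E" using gap[of w] b by auto
    qed
    define \<delta> where "\<delta> = norm (z - c)"
    have "(15 / 16 * \<rho> - \<delta>) * u c \<le> (15 / 16 * \<rho> + \<delta>) * u z"
      unfolding \<delta>_def by (rule harnack_ball[OF harmonic sub]) (use pos sub d \<rho> in auto)
    moreover have "(3 / 80 * \<rho>) * u c \<le> (15 / 16 * \<rho> - \<delta>) * u c"
      using d nonneg[of c] by (intro mult_right_mono) (auto simp: \<delta>_def)
    moreover have "(15 / 16 * \<rho> + \<delta>) * u z \<le> (147 / 80 * \<rho>) * u z"
      using d nonneg[of z] by (intro mult_right_mono) (auto simp: \<delta>_def)
    ultimately have "(3 / 80 * \<rho>) * u c \<le> (3 / 80 * \<rho>) * (49 * u z)" by simp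
    then have "u c \<le> 49 * u z" by (rule mult_left_le_imp_le) (use \<rho> in simp)
    moreover have "u (of_real \<rho>) \<le> 10 * u c"
      by (rule sector[OF nc]) (simp add: c_def)
    ultimately show ?thesis by simp
  qed
qed

text \<open>In an annulus free of \<open>E\<close> the function \<open>u\<close> is nonnegative on the inner circle and at least
\<open>u \<rho> / 490\<close> on the outer one, hence it dominates the logarithm with these boundary values.\<close>

lemma log_minorant_in_gap:
  assumes b: "0 < b" "16 * b \<le> \<rho>" and gap: "\<And>w. w \<in> E \<Longrightarrow> norm w \<le> b \<or> 2 * \<rho> \<le> norm w"
    and w: "b < norm w" "norm w < \<rho>"
  shows "u (of_real \<rho>) * ln (norm w / b) \<le> 490 * ln (\<rho> / b) * u w"
proof -
  have \<rho>: "b < \<rho>" using b by linarith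
  define \<Omega> where "\<Omega> = {w::complex. b < norm w \<and> norm w < \<rho>}"
  define k where "k = u (of_real \<rho>) / (490 * ln (\<rho> / b))"
  have ln: "0 < ln (\<rho> / b)" using b \<rho> by simp
  have op: "open \<Omega>" unfolding \<Omega>_def
    by (intro open_Collect_conj open_Collect_less continuous_intros)
  have bd: "bounded \<Omega>" unfolding bounded_iff by (intro exI[of _ \<rho>]) (auto simp: \<Omega>_def)
  have sub: "\<Omega> \<subseteq> - E" using gap \<rho> b by (fastforce simp: \<Omega>_def)
  have "k * ln (norm w) + (- k * ln b) - u w \<le> 0"
  proof (rule maximum_principle[OF op bd, of "\<lambda>w. k * ln (norm w) + (- k * ln b) - u w"])
    show "locally_Re_holomorphic (\<lambda>w. k * ln (norm w) + (- k * ln b) - u w) \<Omega>"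
      by (intro locally_Re_holomorphic_diff locally_Re_holomorphic_affine op
          locally_Re_holomorphic_subset[OF locally_Re_holomorphic_ln_norm]
          locally_Re_holomorphic_subset[OF harmonic_on_imp_locally_Re_holomorphic[OF harmonic] sub])
        (use b in \<open>auto simp: \<Omega>_def\<close>)
    show "w \<in> \<Omega>" using w by (simp add: \<Omega>_def)
    fix \<zeta> and \<epsilon> :: real assume \<zeta>: "\<zeta> \<in> frontier \<Omega>" and \<epsilon>: "0 < \<epsilon>"
    have "closed {w::complex. b \<le> norm w \<and> norm w \<le> \<rho>}"
      by (intro closed_Collect_conj closed_Collect_le continuous_intros)
    then have "closure \<Omega> \<subseteq> {w. b \<le> norm w \<and> norm w \<le> \<rho>}"
      by (rule closure_minimal[rotated]) (auto simp: \<Omega>_def)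
    moreover have "\<zeta> \<in> closure \<Omega>" "\<zeta> \<notin> \<Omega>" using \<zeta> op by (auto simp: frontier_def interior_open)
    ultimately have or: "norm \<zeta> = b \<or> norm \<zeta> = \<rho>" by (auto simp: \<Omega>_def)
    have \<zeta>0: "\<zeta> \<noteq> 0" using or b \<rho> by auto
    have "k * ln (norm \<zeta>) + (- k * ln b) \<le> u \<zeta>"
      using or
    proof
      assume "norm \<zeta> = b" then show ?thesis using nonneg[of \<zeta>] by simp
    next
      assume *: "norm \<zeta> = \<rho>"
      have "k * ln \<rho> + (- k * ln b) = k * ln (\<rho> / b)" using b \<rho> by (simp add: ln_div algebra_simps)
      also have "\<dots> = u (of_real \<rho>) / 490" using ln by (simp add: k_def)
      also have "\<dots> \<le> u \<zeta>" using axis_le_circle_in_gap[OF b gap *] by simp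
      finally show ?thesis using * by simp
    qed
    moreover have "isCont (\<lambda>w. k * ln (norm w) + (- k * ln b)) \<zeta>"
      by (intro continuous_intros) (use \<zeta>0 in auto)
    ultimately show "\<forall>\<^sub>F w in at \<zeta> within \<Omega>. k * ln (norm w) + (- k * ln b) - u w < \<epsilon>"
      using \<epsilon> by (intro eventually_diff_less_at_within) auto
  qed
  moreover have "w \<noteq> 0" using w b by auto
  ultimately have "k * ln (norm w / b) \<le> u w" using b by (simp add: ln_div algebra_simps)
  then show ?thesis using ln by (simp add: k_def field_simps)
qed

text \<open>Across a gap the maximum grows at most like a logarithm: a large value at radius \<open>\<rho>\<close> would, through the
logarithmic minorant, produce a large value already at radius \<open>4 * b\<close>, where the square root bound
limits it by a multiple of the maximum at radius \<open>b\<close>.\<close>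

lemma max_circle_le_across_gap:
  assumes b: "0 < b" "b \<le> \<rho>" and gap: "\<And>w. w \<in> E \<Longrightarrow> norm w \<le> b \<or> \<rho> \<le> norm w"
  shows "max_circle \<rho> u \<le> 3 * 10 ^ 8 * (1 + ln (\<rho> / b)) * max_circle b u"
proof -
  have \<rho>: "0 < \<rho>" using b by linarith
  define M where "M = max_circle b u"
  have M: "0 < M" unfolding M_def by (rule max_circle_pos[OF b(1)])
  have ln: "0 \<le> ln (\<rho> / b)" using b by simp
  show ?thesis
  proof (cases "\<rho> \<le> 32 * b")
    case True
    have "sqrt (\<rho> / b) \<le> sqrt 36" using True b by (intro real_sqrt_le_mono) (simp add: field_simps)
    then have "sqrt (\<rho> / b) \<le> 6" by simp
    then have "384 * sqrt (\<rho> / b) * M \<le> 384 * 6 * M" using M by (intro mult_right_mono mult_left_mono) auto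
    with max_circle_le_sqrt[OF b] have "max_circle \<rho> u \<le> 384 * 6 * M"
      unfolding M_def by (rule order_trans)
    also have "384 * 6 * M \<le> 3 * 10 ^ 8 * (1 + ln (\<rho> / b)) * M" using M ln by (intro mult_right_mono) auto
    finally show ?thesis by (simp add: M_def)
  next
    case False
    \<comment> \<open>Half the radius, so that the annulus up to \<open>2 * s\<close> is free of \<open>E\<close>; here \<open>s \<ge> 16 * b\<close>.\<close>
    define s where "s = \<rho> / 2"
    have s: "16 * b \<le> s" "0 < s" using False \<rho> by (auto simp: s_def)
    have "u (of_real s) * ln (norm (complex_of_real (4 * b)) / b) \<le> 490 * ln (s / b) * u (of_real (4 * b))"
      by (rule log_minorant_in_gap[OF b(1) s(1)]) (use gap s b in \<open>auto simp: s_def\<close>)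
    then have 1: "u (of_real s) * ln 4 \<le> 490 * ln (s / b) * u (of_real (4 * b))" using b by simp
    have "exp 1 \<le> (4::real)" using exp_le by linarith
    then have "1 \<le> ln (4::real)" by (subst ln_ge_iff) auto
    then have "u (of_real s) * 1 \<le> u (of_real s) * ln 4" using nonneg by (intro mult_left_mono) auto
    then have 2: "u (of_real s) \<le> 490 * ln (s / b) * u (of_real (4 * b))" using 1 by simp
    have "sqrt (4 * b / b) = 2" using b by simp
    then have "max_circle (4 * b) u \<le> 768 * M"
      using max_circle_le_sqrt[of b "4 * b"] b by (simp add: M_def)
    then have 3: "u (of_real (4 * b)) \<le> 768 * M" using axis_le_max_circle[of "4 * b"] b by linarith
    have lns: "0 \<le> ln (s / b)" "ln (s / b) \<le> ln (\<rho> / b)" using s b \<rho> by (auto simp: s_def divide_simps)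
    have "490 * ln (s / b) * u (of_real (4 * b)) \<le> 490 * (1 + ln (\<rho> / b)) * (768 * M)"
      using lns 3 M nonneg by (intro mult_mono) auto
    moreover have "490 * (1 + ln (\<rho> / b)) * (768 * M) = 376320 * ((1 + ln (\<rho> / b)) * M)" by simp
    ultimately have 4: "u (of_real s) \<le> 376320 * ((1 + ln (\<rho> / b)) * M)" using 2 by linarith
    have "sqrt (\<rho> / s) \<le> sqrt 4" using \<rho> by (intro real_sqrt_le_mono) (simp add: s_def)
    then have "sqrt (\<rho> / s) * u (of_real s) \<le> 2 * u (of_real s)" using nonneg by (intro mult_right_mono) auto
    then have "u (of_real \<rho>) \<le> 2 * u (of_real s)"
      using harnack_axis(1)[of s \<rho>] s \<rho> by (simp add: s_def)
    then have "max_circle \<rho> u \<le> 384 * (2 * u (of_real s))"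
      using max_circle_le_axis[OF \<rho>] by linarith
    also have "\<dots> \<le> 3 * 10 ^ 8 * ((1 + ln (\<rho> / b)) * M)"
    proof -
      define X where "X = (1 + ln (\<rho> / b)) * M"
      have "0 \<le> X" using ln M by (simp add: X_def)
      then show ?thesis using 4 unfolding X_def[symmetric] by simp
    qed
    finally show ?thesis by (simp add: M_def mult_ac)
  qed
qed

end

section \<open>Logarithmic measure and accumulated error\<close>

lemma Limsup_ereal_mono_diff:
  fixes f g :: "'a \<Rightarrow> real"
  assumes F: "F \<noteq> bot" and lim: "((\<lambda>x. f x - g x) \<longlongrightarrow> 0) F"
  shows "Limsup F (\<lambda>x. ereal (f x)) \<le> Limsup F (\<lambda>x. ereal (g x))"
    and "Liminf F (\<lambda>x. ereal (f x)) \<le> Liminf F (\<lambda>x. ereal (g x))"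
proof -
  have ev: "\<forall>\<^sub>F x in F. ereal (f x) \<le> ereal (g x) + ereal e" if "0 < e" for e
    using order_tendstoD(2)[OF lim that] by eventually_elim simp
  show "Limsup F (\<lambda>x. ereal (f x)) \<le> Limsup F (\<lambda>x. ereal (g x))"
  proof (rule ereal_le_epsilon2)
    fix e :: real assume "0 < e"
    then have "Limsup F (\<lambda>x. ereal (f x)) \<le> Limsup F (\<lambda>x. ereal (g x) + ereal e)"
      by (intro Limsup_mono ev)
    then show "Limsup F (\<lambda>x. ereal (f x)) \<le> Limsup F (\<lambda>x. ereal (g x)) + ereal e"
      by (subst (asm) Limsup_add_ereal_right[OF F]) auto
  qed
  show "Liminf F (\<lambda>x. ereal (f x)) \<le> Liminf F (\<lambda>x. ereal (g x))"
  proof (rule ereal_le_epsilon2)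
    fix e :: real assume "0 < e"
    then have "Liminf F (\<lambda>x. ereal (f x)) \<le> Liminf F (\<lambda>x. ereal (g x) + ereal e)"
      by (intro Liminf_mono ev)
    then show "Liminf F (\<lambda>x. ereal (f x)) \<le> Liminf F (\<lambda>x. ereal (g x)) + ereal e"
      by (subst (asm) Liminf_add_ereal_right[OF F]) auto
  qed
qed

text \<open>Reduces both equalities of the theorem to a single limit.\<close>

lemma Limsup_Liminf_ereal_eq_of_diff_tendsto_0:
  fixes f g :: "'a \<Rightarrow> real"
  assumes F: "F \<noteq> bot" and lim: "((\<lambda>x. f x - g x) \<longlongrightarrow> 0) F"
  shows "Limsup F (\<lambda>x. ereal (f x)) = Limsup F (\<lambda>x. ereal (g x))"
    and "Liminf F (\<lambda>x. ereal (f x)) = Liminf F (\<lambda>x. ereal (g x))"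
proof -
  have "((\<lambda>x. g x - f x) \<longlongrightarrow> 0) F" using tendsto_minus[OF lim] by simp
  then show "Limsup F (\<lambda>x. ereal (f x)) = Limsup F (\<lambda>x. ereal (g x))"
    and "Liminf F (\<lambda>x. ereal (f x)) = Liminf F (\<lambda>x. ereal (g x))"
    using Limsup_ereal_mono_diff[OF F lim] Limsup_ereal_mono_diff[OF F, of g f]
    by (simp_all add: antisym)
qed

definition log_measure :: "real set \<Rightarrow> real \<Rightarrow> real" where
  "log_measure S r = (LINT t : S \<inter> {1<..<r} | lebesgue. 1 / t)"

lemma log_measure_split:
  assumes S: "S \<in> sets lebesgue" and xy: "1 < x" "x \<le> y"
  shows "log_measure S y = log_measure S x + integral (S \<inter> {x..<y}) (\<lambda>t. 1 / t)"
proof -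
  have int: "set_integrable lebesgue {1..y} (\<lambda>t. 1 / t)"
    by (rule absolutely_integrable_continuous_real) (auto intro!: continuous_intros)
  have i1: "set_integrable lebesgue (S \<inter> {1<..<x}) (\<lambda>t. 1 / t)"
    by (rule set_integrable_subset[OF int]) (use S xy in auto)
  have i2: "set_integrable lebesgue (S \<inter> {x..<y}) (\<lambda>t. 1 / t)"
    by (rule set_integrable_subset[OF int]) (use S xy in auto)
  have "S \<inter> {1<..<y} = (S \<inter> {1<..<x}) \<union> (S \<inter> {x..<y})" using xy by auto
  then have "log_measure S y = log_measure S x + (LINT t : S \<inter> {x..<y} | lebesgue. 1 / t)"
    unfolding log_measure_def using set_integral_Un[OF _ i1 i2] by force
  then show ?thesis using set_lebesgue_integral_eq_integral(2)[OF i2] by simp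
qed

lemma log_measure_interval:
  assumes S: "S \<in> sets lebesgue" and xy: "1 < x" "x \<le> y" and sub: "{x..y} \<subseteq> S"
  shows "log_measure S y = log_measure S x + ln (y / x)"
proof -
  have "((\<lambda>t. 1 / t) has_integral (ln y - ln x)) {x..y}"
    using xy by (intro fundamental_theorem_of_calculus)
      (auto intro!: derivative_eq_intros simp flip: has_real_derivative_iff_has_vector_derivative)
  then have "integral {x..y} (\<lambda>t. 1 / t) = ln (y / x)"
    using xy by (simp add: integral_unique ln_div)
  moreover have "integral (S \<inter> {x..<y}) (\<lambda>t. 1 / t) = integral {x..y} (\<lambda>t. 1 / t)"
    by (rule integral_spike_set; rule negligible_subset[of "{y}"]) (use sub in auto)
  ultimately show ?thesis using log_measure_split[OF S xy] by simp
qed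

lemma log_measure_gap:
  assumes S: "S \<in> sets lebesgue" and xy: "1 < x" "x \<le> y" and gap: "{x<..<y} \<inter> S = {}"
  shows "log_measure S y = log_measure S x"
proof -
  have "integral (S \<inter> {x..<y}) (\<lambda>t. 1 / t) = integral {} (\<lambda>t. 1 / t)"
    by (rule integral_spike_set; rule negligible_subset[of "{x}"]) (use gap in force)+
  then show ?thesis using log_measure_split[OF S xy] by simp
qed

text \<open>The constant term comes from \<open>ln y \<le> y - 1\<close> at \<open>y = \<epsilon> * (1 + x)\<close>. An arbitrarily small proportion of
\<open>x\<close> suffices, at the price of a constant.\<close>

lemma ln_one_plus_le:
  fixes x \<epsilon> :: real
  assumes "0 \<le> x" "0 < \<epsilon>"
  shows "ln (1 + x) \<le> (\<epsilon> - 1 - ln \<epsilon>) + \<epsilon> * x"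
proof -
  have "ln (\<epsilon> * (1 + x)) \<le> \<epsilon> * (1 + x) - 1" using assms by (intro ln_le_minus_one) auto
  moreover have "ln (\<epsilon> * (1 + x)) = ln \<epsilon> + ln (1 + x)" using assms by (subst ln_mult) auto
  moreover have "\<epsilon> * (1 + x) = \<epsilon> + \<epsilon> * x" by (simp add: algebra_simps)
  ultimately show ?thesis by linarith
qed

lemma interval_sequence_less:
  fixes a b :: "nat \<Rightarrow> real"
  assumes "\<And>n. a n < b n" "\<And>n. b n < a (Suc n)" "m < n"
  shows "b m < a n"
proof -
  have "strict_mono a" using assms(1,2) by (intro strict_monoI_Suc) (meson less_trans)
  then have "a (Suc m) \<le> a n" using assms(3) by (simp add: strict_mono_less_eq)
  then show ?thesis using assms(2)[of m] by linarith
qed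

lemma exists_step_containing:
  fixes a :: "nat \<Rightarrow> real"
  assumes "filterlim a at_top sequentially" "a N \<le> r"
  obtains n where "N \<le> n" "a n \<le> r" "r < a (Suc n)"
proof -
  have "\<exists>m. m \<ge> N \<and> r < a m"
    using assms(1) unfolding filterlim_at_top_dense eventually_sequentially
    by (metis le_refl nat_le_linear)
  then have ex: "\<exists>k. r < a (N + k)" by (metis le_Suc_ex)
  define k where "k = (LEAST k. r < a (N + k))"
  have k: "r < a (N + k)" unfolding k_def using ex by (rule LeastI_ex)
  then have "k \<noteq> 0" using assms(2) by (intro notI) simp
  then obtain j where j: "k = Suc j" using not0_implies_Suc by blast
  have "\<not> r < a (N + j)" using not_less_Least[of j "\<lambda>k. r < a (N + k)"] j unfolding k_def by simp
  then show ?thesis using that[of "N + j"] k j by simp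
qed

text \<open>An error that changes by at most \<open>C\<close> on each interval and by at most \<open>C + ln (1 + ln (r / b n))\<close> on each
gap is \<open>o(ln r)\<close>. The logarithmic terms are at most \<open>\<epsilon>\<close> times the logarithmic length of the gaps plus
constants, the logarithmic lengths add up to at most \<open>ln r\<close>, and the number of constants is \<open>o(ln r)\<close>
because \<open>a n\<close> grows faster than any geometric progression.\<close>

lemma error_over_ln_tendsto_0:
  fixes a b :: "nat \<Rightarrow> real" and T :: "real \<Rightarrow> real" and C :: real
  assumes ab: "\<And>n. a n < b n" "\<And>n. b n < a (Suc n)" and a_top: "filterlim a at_top sequentially"
    and root: "filterlim (\<lambda>n. root n (a n)) at_top sequentially"
    and N: "1 < a N"
    and slit: "\<And>n r. \<lbrakk>N \<le> n; a n \<le> r; r \<le> b n\<rbrakk> \<Longrightarrow> \<bar>T r - T (a n)\<bar> \<le> C"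
    and gap: "\<And>n r. \<lbrakk>N \<le> n; b n \<le> r; r \<le> a (Suc n)\<rbrakk> \<Longrightarrow> \<bar>T r - T (b n)\<bar> \<le> C + ln (1 + ln (r / b n))"
  shows "((\<lambda>r. T r / ln r) \<longlongrightarrow> 0) at_top"
proof (rule tendstoI)
  fix e :: real assume e: "0 < e"
  define \<epsilon> where "\<epsilon> = e / 3"
  have \<epsilon>: "0 < \<epsilon>" using e by (simp add: \<epsilon>_def)
  \<comment> \<open>Bounds the constant part of the increment on an interval as well as on a gap.\<close>
  define D where "D = C + (\<epsilon> - 1 - ln \<epsilon>)"
  have sm: "strict_mono a" using ab by (intro strict_monoI_Suc) (meson less_trans)
  have a1: "1 < a n" if "N \<le> n" for n
    using N strict_mono_less_eq[OF sm, of N n] that by linarith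
  have K: "0 \<le> \<epsilon> - 1 - ln \<epsilon>" using ln_one_plus_le[of 0 \<epsilon>] \<epsilon> by simp
  have C: "0 \<le> C" using slit[of N "a N"] ab(1)[of N] by simp
  have D: "0 \<le> D" "C \<le> D" using K C by (auto simp: D_def)
  have gap': "\<bar>T r - T (b n)\<bar> \<le> D + \<epsilon> * (ln r - ln (a n))" if "N \<le> n" "b n \<le> r" "r \<le> a (Suc n)" for n r
  proof -
    have pos: "0 < a n" "0 < b n" "0 < r" using a1[OF that(1)] ab(1)[of n] that by linarith+
    have "ln (1 + ln (r / b n)) \<le> (\<epsilon> - 1 - ln \<epsilon>) + \<epsilon> * ln (r / b n)"
      using that pos \<epsilon> by (intro ln_one_plus_le) auto
    moreover have "\<epsilon> * ln (r / b n) \<le> \<epsilon> * (ln r - ln (a n))"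
      using \<epsilon> pos ab(1)[of n] by (intro mult_left_mono) (auto simp: ln_div)
    ultimately show ?thesis using gap[OF that] by (simp add: D_def)
  qed
  define K0 where "K0 = \<bar>T (a N)\<bar>"
  have start: "\<bar>T (a n)\<bar> \<le> K0 + 2 * D * real n + \<epsilon> * ln (a n)" if "N \<le> n" for n
    using that
  proof (induction n rule: dec_induct)
    case base
    have "0 \<le> 2 * D * real N + \<epsilon> * ln (a N)" using D \<epsilon> N by (intro add_nonneg_nonneg) auto
    then show ?case by (simp add: K0_def)
  next
    case (step n)
    have 1: "\<bar>T (b n) - T (a n)\<bar> \<le> D" using slit[of n "b n"] ab(1)[of n] step D by simp
    have 2: "\<bar>T (a (Suc n)) - T (b n)\<bar> \<le> D + \<epsilon> * (ln (a (Suc n)) - ln (a n))"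
      using gap'[of n "a (Suc n)"] ab(2)[of n] step by simp
    have "K0 + 2 * D * real n + \<epsilon> * ln (a n) + D + (D + \<epsilon> * (ln (a (Suc n)) - ln (a n))) =
          K0 + 2 * D * real (Suc n) + \<epsilon> * ln (a (Suc n))"
      by (simp add: algebra_simps)
    then show ?case using step.IH 1 2 by linarith
  qed
  have bound: "\<bar>T r\<bar> \<le> K0 + 2 * D * real (Suc n) + \<epsilon> * ln r"
    if n: "N \<le> n" "a n \<le> r" "r \<le> a (Suc n)" for n r
  proof -
    have pos: "1 < a n" "0 < r" using a1[OF n(1)] n by linarith+
    have mono: "\<epsilon> * ln (a n) \<le> \<epsilon> * ln r" using n pos \<epsilon> by (intro mult_left_mono) auto
    have S: "2 * D * real (Suc n) = 2 * D * real n + 2 * D" by (simp add: algebra_simps)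
    show ?thesis
    proof (cases "r \<le> b n")
      case True
      then have "\<bar>T r - T (a n)\<bar> \<le> D" using slit n D by fastforce
      then show ?thesis using start[OF n(1)] mono S D by linarith
    next
      case False
      have 1: "\<bar>T (b n) - T (a n)\<bar> \<le> D" using slit[of n "b n"] ab(1)[of n] n D by simp
      have 2: "\<bar>T r - T (b n)\<bar> \<le> D + \<epsilon> * (ln r - ln (a n))" using gap'[of n r] n False by simp
      have "\<epsilon> * (ln r - ln (a n)) = \<epsilon> * ln r - \<epsilon> * ln (a n)" by (simp add: algebra_simps)
      then show ?thesis using start[OF n(1)] 1 2 S by linarith
    qed
  qed
  \<comment> \<open>Chosen so that \<open>a n \<ge> exp (n * Q)\<close> absorbs \<open>K0 + 2 * D * (n + 1)\<close> into \<open>\<epsilon> * ln (a n)\<close>.\<close>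
  define Q where "Q = (K0 + 4 * D) / \<epsilon>"
  have "\<forall>\<^sub>F n in sequentially. exp Q \<le> root n (a n)"
    using root unfolding filterlim_at_top by blast
  then obtain N1 where N1: "\<And>n. N1 \<le> n \<Longrightarrow> exp Q \<le> root n (a n)"
    unfolding eventually_sequentially by blast
  define N2 where "N2 = max (Suc N) N1"
  have ln_a: "K0 + 2 * D * real (Suc n) \<le> \<epsilon> * ln (a n)" if "N2 \<le> n" for n
  proof -
    have n: "N \<le> n" "N1 \<le> n" "1 \<le> n" using that by (auto simp: N2_def)
    have pos: "0 < a n" using a1[OF n(1)] by linarith
    have "exp Q ^ n \<le> root n (a n) ^ n" using N1[OF n(2)] by (intro power_mono) auto
    also have "\<dots> = a n" using n pos by simp
    finally have "exp (real n * Q) \<le> a n" by (simp add: exp_of_nat_mult)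
    then have "real n * Q \<le> ln (a n)" using pos by (simp add: ln_ge_iff)
    then have "\<epsilon> * (real n * Q) \<le> \<epsilon> * ln (a n)" using \<epsilon> by (intro mult_left_mono) auto
    moreover have "\<epsilon> * Q = K0 + 4 * D" using \<epsilon> by (simp add: Q_def)
    then have "\<epsilon> * (real n * Q) = K0 * real n + 4 * D * real n"
      by (metis (no_types) distrib_right mult.left_commute mult.commute)
    moreover have "K0 * 1 \<le> K0 * real n" "D * 1 \<le> D * real n"
      using n D by (intro mult_left_mono; simp add: K0_def)+
    ultimately show ?thesis by (simp add: algebra_simps)
  qed
  have "dist (T r / ln r) 0 < e" if r: "a N2 \<le> r" for r
  proof -
    obtain n where n: "N2 \<le> n" "a n \<le> r" "r < a (Suc n)"
      using exists_step_containing[OF a_top r] by blast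
    have Nn: "N \<le> n" using n by (simp add: N2_def)
    have an: "1 < a n" by (rule a1[OF Nn])
    have "\<epsilon> * ln (a n) \<le> \<epsilon> * ln r" using n an \<epsilon> by (intro mult_left_mono) auto
    then have "\<bar>T r\<bar> \<le> 2 * \<epsilon> * ln r" using bound[OF Nn n(2)] n(3) ln_a[OF n(1)] by linarith
    moreover have ln: "0 < ln r" using n an by simp
    ultimately have "\<bar>T r / ln r\<bar> \<le> 2 * \<epsilon>" by (simp add: field_simps)
    moreover have "2 * \<epsilon> < e" using e by (simp add: \<epsilon>_def)
    ultimately show ?thesis unfolding dist_real_def by linarith
  qed
  then show "\<forall>\<^sub>F r in at_top. dist (T r / ln r) 0 < e"
    unfolding eventually_at_top_linorder by blast
qed

section \<open>Order and logarithmic density\<close>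

theorem theorem1p3:
  fixes u :: "complex \<Rightarrow> real" and E :: "complex set" and a b :: "nat \<Rightarrow> real"
  assumes "class_K u E"
    and "E = complex_of_real ` (\<Union>n. {- b n .. - a n})"
    and "0 \<le> a 0"
    and "\<And>n. a n < b n"
    and "\<And>n. b n < a (Suc n)"
    and "filterlim a at_top sequentially"
    and "filterlim (\<lambda>n. root n (a n)) at_top sequentially"
  shows "growth_order u = ereal (1/2) * upper_log_density (cmod ` E) \<and>
         lower_growth_order u = ereal (1/2) * lower_log_density (cmod ` E)"
proof -
  interpret class_K_function u E by (unfold_locales) (rule assms(1))
  define S where "S = cmod ` E"
  define B where "B r = max_circle r u" for r
  \<comment> \<open>Both equalities follow once \<open>T\<close> is known to be \<open>o(ln r)\<close>.\<close>
  define T where "T r = ln (B r) - log_measure S r / 2" for r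
  define C :: real where "C = ln (3 * 10 ^ 8)"
  have sm: "strict_mono a" using assms(4,5) by (intro strict_monoI_Suc) (meson less_trans)
  have a0: "0 \<le> a n" for n using assms(3) strict_mono_less_eq[OF sm, of 0 n] by simp
  have S_eq: "S = (\<Union>n. {a n..b n})"
  proof -
    have "S = (\<lambda>x. \<bar>x\<bar>) ` (\<Union>n. {- b n .. - a n})"
      unfolding S_def assms(2) by (simp add: image_image)
    also have "\<dots> = (\<Union>n. {a n..b n})"
    proof (intro equalityI subsetI)
      fix x assume "x \<in> (\<lambda>x. \<bar>x\<bar>) ` (\<Union>n. {- b n .. - a n})"
      then obtain n y where "y \<in> {- b n .. - a n}" "x = \<bar>y\<bar>" by blast
      then show "x \<in> (\<Union>n. {a n..b n})" using a0[of n] by (intro UN_I[of n]) auto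
    next
      fix x assume "x \<in> (\<Union>n. {a n..b n})"
      then obtain n where n: "x \<in> {a n..b n}" by blast
      then have "x = \<bar>- x\<bar>" using a0[of n] by simp
      moreover have "- x \<in> (\<Union>n. {- b n .. - a n})" using n by auto
      ultimately show "x \<in> (\<lambda>x. \<bar>x\<bar>) ` (\<Union>n. {- b n .. - a n})" by blast
    qed
    finally show ?thesis .
  qed
  have S_meas: "S \<in> sets lebesgue" unfolding S_eq by (intro sets.countable_UN) auto
  have gap_S: "s \<le> b n \<or> a (Suc n) \<le> s" if "s \<in> S" for s n
  proof -
    from that obtain m where m: "a m \<le> s" "s \<le> b m" unfolding S_eq by auto
    show ?thesis
    proof (cases "m \<le> n")
      case True
      then have "b m \<le> b n"
        using interval_sequence_less[of a b m n] assms(4,5) by (cases "m = n") (auto intro: less_imp_le less_trans)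
      then show ?thesis using m by simp
    next
      case False
      then have "a (Suc n) \<le> a m" using strict_mono_less_eq[OF sm] by simp
      then show ?thesis using m by simp
    qed
  qed
  obtain N where N: "1 < a N"
    using assms(6) unfolding filterlim_at_top_dense eventually_sequentially by blast
  have a1: "1 < a n" if "N \<le> n" for n
    using N strict_mono_less_eq[OF sm, of N n] that by linarith
  have Bpos: "0 < B r" if "0 < r" for r unfolding B_def by (rule max_circle_pos[OF that])
  have lim: "((\<lambda>r. T r / ln r) \<longlongrightarrow> 0) at_top"
  proof (rule error_over_ln_tendsto_0[OF assms(4,5,6,7) N])
    fix n r assume n: "N \<le> n" and r: "a n \<le> r" "r \<le> b n"
    have pos: "1 < a n" "0 < a n" "0 < r" using a1[OF n] r by linarith+
    have L: "log_measure S r = log_measure S (a n) + ln (r / a n)"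
    proof (rule log_measure_interval[OF S_meas pos(1) r(1)])
      show "{a n..r} \<subseteq> S" unfolding S_eq using r(2) by (intro SUP_upper2[of n]) auto
    qed
    have half: "ln (sqrt (r / a n)) = ln (r / a n) / 2" using pos by (simp add: ln_sqrt)
    have "ln (B r) \<le> ln (384 * sqrt (r / a n) * B (a n))"
      using max_circle_le_sqrt[OF pos(2) r(1)] Bpos pos by (simp add: B_def)
    also have "\<dots> = ln 384 + ln (r / a n) / 2 + ln (B (a n))"
      using Bpos[OF pos(2)] pos by (simp add: ln_mult half)
    finally have up: "ln (B r) \<le> ln 384 + ln (r / a n) / 2 + ln (B (a n))" .
    have "complex_of_real ` {- r..- a n} \<subseteq> E" unfolding assms(2) by (intro image_mono SUP_upper2[of n]) (use r in auto)
    then have "ln (B (a n)) \<le> ln (7 * sqrt (a n / r) * B r)"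
      using max_circle_le_across_slit[OF pos(2) r(1)] Bpos pos by (simp add: B_def)
    also have "\<dots> = ln 7 + ln (a n / r) / 2 + ln (B r)"
      using Bpos[OF pos(3)] pos by (simp add: ln_mult ln_sqrt)
    also have "ln (a n / r) = - ln (r / a n)" using pos by (simp add: ln_div)
    finally have lo: "ln (B (a n)) \<le> ln 7 - ln (r / a n) / 2 + ln (B r)" by simp
    have "ln 384 \<le> C" "ln 7 \<le> C" by (simp_all add: C_def)
    moreover have "T r - T (a n) = ln (B r) - ln (B (a n)) - ln (r / a n) / 2"
      unfolding T_def L by (simp add: add_divide_distrib)
    ultimately show "\<bar>T r - T (a n)\<bar> \<le> C" using up lo by linarith
  next
    fix n r assume n: "N \<le> n" and r: "b n \<le> r" "r \<le> a (Suc n)"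
    have pos: "1 < b n" "0 < b n" "0 < r" using a1[OF n] r assms(4)[of n] by linarith+
    have L: "log_measure S r = log_measure S (b n)"
      by (rule log_measure_gap[OF S_meas pos(1) r(1)]) (use gap_S[of _ n] r in fastforce)
    have ln: "0 \<le> ln (r / b n)" using pos r by simp
    have "ln (B (b n)) \<le> ln (B r)"
      using max_circle_mono[of "b n" r] Bpos pos r by (simp add: B_def)
    moreover have "max_circle r u \<le> 3 * 10 ^ 8 * (1 + ln (r / b n)) * max_circle (b n) u"
      by (rule max_circle_le_across_gap[OF pos(2) r(1)]) (use gap_S[of _ n] r in \<open>force simp: S_def\<close>)
    then have "ln (B r) \<le> ln (3 * 10 ^ 8 * (1 + ln (r / b n)) * B (b n))"
      using Bpos[OF pos(3)] unfolding B_def by (intro ln_mono) auto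
    moreover have "ln (3 * 10 ^ 8 * (1 + ln (r / b n)) * B (b n)) = C + ln (1 + ln (r / b n)) + ln (B (b n))"
      using Bpos[OF pos(2)] ln unfolding C_def by (subst ln_mult; (subst ln_mult)?; simp)
    moreover have "0 \<le> C" "0 \<le> ln (1 + ln (r / b n))" using ln by (simp_all add: C_def)
    moreover have "T r - T (b n) = ln (B r) - ln (B (b n))" unfolding T_def L by simp
    ultimately show "\<bar>T r - T (b n)\<bar> \<le> C + ln (1 + ln (r / b n))" by linarith
  qed
  have diff: "((\<lambda>r. ln (max_circle r u) / ln r - 1 / 2 * (1 / ln r * log_measure S r)) \<longlongrightarrow> 0) at_top"
    using lim by (simp add: T_def B_def diff_divide_distrib)
  have "growth_order u = Limsup at_top (\<lambda>r. ereal (1 / 2) * ereal (1 / ln r * log_measure S r))"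
    unfolding growth_order_def
    using Limsup_Liminf_ereal_eq_of_diff_tendsto_0(1)[OF trivial_limit_at_top_linorder diff] by simp
  also have "\<dots> = ereal (1 / 2) * upper_log_density S"
    unfolding upper_log_density_def log_measure_def by (rule Limsup_ereal_mult_left) auto
  finally have 1: "growth_order u = ereal (1 / 2) * upper_log_density S" .
  have "lower_growth_order u = Liminf at_top (\<lambda>r. ereal (1 / 2) * ereal (1 / ln r * log_measure S r))"
    unfolding lower_growth_order_def
    using Limsup_Liminf_ereal_eq_of_diff_tendsto_0(2)[OF trivial_limit_at_top_linorder diff] by simp
  also have "\<dots> = ereal (1 / 2) * lower_log_density S"
    unfolding lower_log_density_def log_measure_def by (rule Liminf_ereal_mult_left) auto
  finally have 2: "lower_growth_order u = ereal (1 / 2) * lower_log_density S" .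
  show ?thesis using 1 2 by (simp add: S_def)
qed

end
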